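(* Let $l\in\mathbb{N}$ and let $S\subseteq\mathbb{R}^n$ be a real affine algebraic variety defined by $G_1,\dots,G_m\in\mathbb{R}[x_1,\dots,x_n]$ with $m\le n-l$. For every $i\in\{1,\dots,n\}$, let $\delta_i$ be the maximum of the degrees of $x_i$ in $G_1,\dots,G_m$, and let $\delta=\delta_1+\cdots+\delta_n$. Then there exists a $(\delta+n+l)$-player game $X$ with binary choices such that the affine open subset $U_{X,l}$ of $Y_{X,l}$ is isomorphic to $S$ (as real algebraic varieties).
   Context: Notation: $[m]=\{1,\dots,m\}$. In this statement varieties are real algebraic varieties (real zero sets), and isomorphism is isomorphism of algebraic varieties. Game. An $N$-player game $X$ with binary choices is given by real payoff tensors $X^{(1)},\dots,X^{(N)}$ of format $2\times\cdots\times2$, with entries $X^{(i)}_{j_1\cdots j_N}$, $j\in[2]^N$. The Spohn variety $\mathcal{V}_X\subseteq\mathbb{P}^{2^N-1}$ (coordinates $p_{j_1\cdots j_N}$) is the zero locus of $\det M_1,\dots,\det M_N$, where the $a$-th row ($a=1,2$) of $M_i$ is $\big(\sum_{j:\,j_i=a}p_j,\ \sum_{j:\,j_i=a}X^{(i)}_jp_j\big)$. The variety $Y_{X,l}$. Consider the partition of the $N$ players into $N-2l$ singletons followed by $l$ pairs (this requires $N\ge2l$). The corresponding independence model is the Segre variety $\mathcal{M}_{\mathbf{n}}=(\mathbb{P}^1)^{N-2l}\times(\mathbb{P}^3)^l\subset\mathbb{P}^{2^N-1}$, with coordinates $\sigma^{(i)}_1,\sigma^{(i)}_2$ on the $i$-th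 factor $\mathbb{P}^1$ ($i\in[N-2l]$) and $\sigma^{(N-2l+r)}_{ab}$, $a,b\in[2]$, on the $r$-th factor $\mathbb{P}^3$ ($r\in[l]$), parametrized by $$p_{j_1\cdots j_N}=\prod_{i=1}^{N-2l}\sigma^{(i)}_{j_i}\prod_{r=1}^l\sigma^{(N-2l+r)}_{j_{N-2l+2r-1}\,j_{N-2l+2r}}.$$ Let $\mathcal{W}$ be the union of all coordinate hyperplanes $\{p_j=0\}$ and of the hyperplane $\{p_{++\cdots+}=0\}$, where $p_{++\cdots+}$ is the sum of all coordinates. The Nash conditional independence variety is $Y_{X,l}:=\overline{(\mathcal{V}_X\cap\mathcal{M}_{\mathbf{n}})\setminus\mathcal{W}}$ (Zariski closure). The affine open subset $U_{X,l}\subset Y_{X,l}$ is defined by $\sigma^{(1)}_2,\dots,\sigma^{(N-2l)}_2,\sigma^{(N-2l+1)}_{22},\dots,\sigma^{(N-l)}_{22}\neq0$. *)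

theory Defs
  imports "HOL-Analysis.Analysis" "HOL-Library.Poly_Mapping"
begin

section \<open>Real polynomials in the variables \<open>x\<^sub>i\<close>\<close>

type_synonym 'v rpoly = "('v \<Rightarrow>\<^sub>0 nat) \<Rightarrow>\<^sub>0 real"

definition polys :: "'v set \<Rightarrow> 'v rpoly set" where
  "polys I = {P. \<forall>m \<in> Poly_Mapping.keys P. Poly_Mapping.keys m \<subseteq> I}"

definition peval :: "('v \<Rightarrow> real) \<Rightarrow> 'v rpoly \<Rightarrow> real" where
  "peval x P = (\<Sum>m \<in> Poly_Mapping.keys P.
     Poly_Mapping.lookup P m * (\<Prod>i \<in> Poly_Mapping.keys m. x i ^ Poly_Mapping.lookup m i))"

text \<open>The zero polynomial is given degree 0 in every variable.\<close>

definition deg_in :: "'v \<Rightarrow> 'v rpoly \<Rightarrow> nat" where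
  "deg_in i P = Max (insert 0 ((\<lambda>m. Poly_Mapping.lookup m i) ` Poly_Mapping.keys P))"

text \<open>The maximum over an empty family (\<open>m = 0\<close>) is 0.\<close>

definition max_deg_in :: "nat \<Rightarrow> (nat \<Rightarrow> 'v rpoly) \<Rightarrow> 'v \<Rightarrow> nat" where
  "max_deg_in m G i = Max (insert 0 ((\<lambda>k. deg_in i (G k)) ` {1..m}))"

definition homogeneous :: "nat \<Rightarrow> 'v rpoly \<Rightarrow> bool" where
  "homogeneous d P \<longleftrightarrow>
     (\<forall>m \<in> Poly_Mapping.keys P. (\<Sum>i \<in> Poly_Mapping.keys m. Poly_Mapping.lookup m i) = d)"


section \<open>Affine and projective space with their Zariski topologies\<close>

definition affine_space :: "'v set \<Rightarrow> ('v \<Rightarrow> real) set" where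
  "affine_space I = I \<rightarrow>\<^sub>E UNIV"

definition zero_locus :: "'v set \<Rightarrow> 'v rpoly set \<Rightarrow> ('v \<Rightarrow> real) set" where
  "zero_locus I F = {x \<in> affine_space I. \<forall>P \<in> F. peval x P = 0}"

text \<open>A point of projective space is the set of all its vectors of homogeneous coordinates.\<close>

definition proj_point :: "'v set \<Rightarrow> ('v \<Rightarrow> real) \<Rightarrow> ('v \<Rightarrow> real) set" where
  "proj_point J v = {w \<in> affine_space J. \<exists>c. c \<noteq> 0 \<and> (\<forall>j \<in> J. w j = c * v j)}"

definition proj_space :: "'v set \<Rightarrow> ('v \<Rightarrow> real) set set" where
  "proj_space J = {proj_point J v | v. v \<in> affine_space J \<and> (\<exists>j \<in> J. v j \<noteq> 0)}"

text \<open>Both topologies are generated by the complements of hypersurfaces.\<close>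

definition zariski_affine :: "'v set \<Rightarrow> ('v \<Rightarrow> real) topology" where
  "zariski_affine I = topology_generated_by
     {{x \<in> affine_space I. peval x P \<noteq> 0} | P. P \<in> polys I}"

definition zariski_proj :: "'v set \<Rightarrow> ('v \<Rightarrow> real) set topology" where
  "zariski_proj J = topology_generated_by
     {{x \<in> proj_space J. \<forall>v \<in> x. peval v P \<noteq> 0} | P. P \<in> polys J \<and> (\<exists>d. homogeneous d P)}"


section \<open>Real algebraic varieties and their isomorphisms\<close>

text \<open>
  A variety is treated as a space with functions: a Zariski topology together with the
  regular functions on each open set. As usual for real varieties, given by their
  real points, a function is regular if it is locally a quotient of polynomials
  (homogeneous of equal degree in the projective case) whose denominator has no zero there.
\<close>

record 'a variety =
  zariski :: "'a topology"
  regular :: "'a set \<Rightarrow> ('a \<Rightarrow> real) set"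

definition affine_variety :: "'v set \<Rightarrow> ('v \<Rightarrow> real) set \<Rightarrow> ('v \<Rightarrow> real) variety" where
  "affine_variety I S =
    \<lparr> zariski = subtopology (zariski_affine I) S,
      regular = (\<lambda>V. {h. \<forall>x \<in> V. \<exists>W P Q.
        openin (subtopology (zariski_affine I) S) W \<and> x \<in> W \<and> W \<subseteq> V \<and>
        P \<in> polys I \<and> Q \<in> polys I \<and>
        (\<forall>y \<in> W. peval y Q \<noteq> 0 \<and> h y = peval y P / peval y Q)}) \<rparr>"

definition quasiproj_variety ::
  "'v set \<Rightarrow> ('v \<Rightarrow> real) set set \<Rightarrow> ('v \<Rightarrow> real) set variety" where
  "quasiproj_variety J Y =
    \<lparr> zariski = subtopology (zariski_proj J) Y,
      regular = (\<lambda>V. {h. \<forall>x \<in> V. \<exists>W P Q d.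
        openin (subtopology (zariski_proj J) Y) W \<and> x \<in> W \<and> W \<subseteq> V \<and>
        P \<in> polys J \<and> Q \<in> polys J \<and> homogeneous d P \<and> homogeneous d Q \<and>
        (\<forall>y \<in> W. \<forall>v \<in> y. peval v Q \<noteq> 0 \<and> h y = peval v P / peval v Q)}) \<rparr>"

definition morphism :: "'a variety \<Rightarrow> 'b variety \<Rightarrow> ('a \<Rightarrow> 'b) \<Rightarrow> bool" where
  "morphism A B f \<longleftrightarrow>
     continuous_map (zariski A) (zariski B) f \<and>
     (\<forall>V h. openin (zariski B) V \<and> h \<in> regular B V \<longrightarrow>
        h \<circ> f \<in> regular A {x \<in> topspace (zariski A). f x \<in> V})"

definition isomorphic_varieties :: "'a variety \<Rightarrow> 'b variety \<Rightarrow> bool" where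
  "isomorphic_varieties A B \<longleftrightarrow>
     (\<exists>f g. morphism A B f \<and> morphism B A g \<and>
        (\<forall>x \<in> topspace (zariski A). g (f x) = x) \<and>
        (\<forall>y \<in> topspace (zariski B). f (g y) = y))"


section \<open>Binary games and Spohn varieties\<close>

definition profiles :: "nat \<Rightarrow> (nat \<Rightarrow> nat) set" where
  "profiles N = {1..N} \<rightarrow>\<^sub>E {1, 2}"

text \<open>\<open>X i j\<close> is the payoff of player \<open>i\<close> at \<open>j\<close>; only \<open>i \<in> {1..N}\<close>, \<open>j \<in> profiles N\<close> matter.\<close>

type_synonym game = "nat \<Rightarrow> (nat \<Rightarrow> nat) \<Rightarrow> real"

definition spohn_matrix ::
  "nat \<Rightarrow> game \<Rightarrow> nat \<Rightarrow> ((nat \<Rightarrow> nat) \<Rightarrow> real) \<Rightarrow> real^2^2" where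
  "spohn_matrix N X i p =
     (let row = (\<lambda>a. vector [\<Sum>j \<in> {j \<in> profiles N. j i = a}. p j,
                             \<Sum>j \<in> {j \<in> profiles N. j i = a}. X i j * p j])
      in vector [row 1, row 2])"

definition spohn_variety :: "nat \<Rightarrow> game \<Rightarrow> ((nat \<Rightarrow> nat) \<Rightarrow> real) set set" where
  "spohn_variety N X =
     {x \<in> proj_space (profiles N). \<forall>i \<in> {1..N}. \<forall>p \<in> x. det (spohn_matrix N X i p) = 0}"


section \<open>Nash conditional independence varieties for singletons and pairs\<close>

text \<open>
  \<open>s i\<close> holds the coordinates on the \<open>i\<close>-th projective line and \<open>t r\<close> those on the
  \<open>r\<close>-th projective 3-space; throughout \<open>2 * l \<le> N\<close>.
\<close>

definition segre ::
  "nat \<Rightarrow> nat \<Rightarrow> (nat \<Rightarrow> nat \<Rightarrow> real) \<Rightarrow> (nat \<Rightarrow> nat \<Rightarrow> nat \<Rightarrow> real) \<Rightarrow> (nat \<Rightarrow> nat) \<Rightarrow> real"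
where
  "segre N l s t j =
     (\<Prod>i \<in> {1..N - 2 * l}. s i (j i)) *
     (\<Prod>r \<in> {1..l}. t r (j (N - 2 * l + 2 * r - 1)) (j (N - 2 * l + 2 * r)))"

definition indep_model :: "nat \<Rightarrow> nat \<Rightarrow> ((nat \<Rightarrow> nat) \<Rightarrow> real) set set" where
  "indep_model N l = {proj_point (profiles N) (segre N l s t) | s t.
     (\<forall>i \<in> {1..N - 2 * l}. \<exists>a \<in> {1, 2}. s i a \<noteq> 0) \<and>
     (\<forall>r \<in> {1..l}. \<exists>a \<in> {1, 2}. \<exists>b \<in> {1, 2}. t r a b \<noteq> 0)}"

definition excluded_hyperplanes :: "nat \<Rightarrow> ((nat \<Rightarrow> nat) \<Rightarrow> real) set set" where
  "excluded_hyperplanes N = {x \<in> proj_space (profiles N).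
     \<forall>p \<in> x. (\<exists>j \<in> profiles N. p j = 0) \<or> (\<Sum>j \<in> profiles N. p j) = 0}"

definition nash_ci_variety :: "nat \<Rightarrow> game \<Rightarrow> nat \<Rightarrow> ((nat \<Rightarrow> nat) \<Rightarrow> real) set set" where
  "nash_ci_variety N X l = zariski_proj (profiles N) closure_of
     (spohn_variety N X \<inter> indep_model N l - excluded_hyperplanes N)"

definition nash_ci_affine :: "nat \<Rightarrow> game \<Rightarrow> nat \<Rightarrow> ((nat \<Rightarrow> nat) \<Rightarrow> real) set set" where
  "nash_ci_affine N X l = nash_ci_variety N X l \<inter>
     {proj_point (profiles N) (segre N l s t) | s t.
       (\<forall>i \<in> {1..N - 2 * l}. s i 2 \<noteq> 0) \<and> (\<forall>r \<in> {1..l}. t r 2 2 \<noteq> 0)}"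

end

theory Submission
  imports Defs
begin

text \<open>
  Write \<open>d i\<close> for the maximal degree of \<open>x\<^sub>i\<close> in the given polynomials. In the affine chart, the
  game has one free coordinate for each singleton player and three for each pair. Every affine
  coordinate \<open>x\<^sub>i\<close> gets \<open>d i + 1\<close> slots \<open>(i, 0), \<dots>, (i, d i)\<close>, which are meant to carry copies of
  \<open>x\<^sub>i - c\<^sub>i\<close>. There are \<open>\<delta> + n\<close> slots; the slots \<open>(i, 0)\<close> of the last \<open>l\<close> coordinates are given to the
  pairs and all others to the \<open>\<delta> + n - l\<close> singletons.

  If a player is paid nothing for the first choice, the determinant of the Spohn matrix is a
  product of two sums over profiles (\<open>det_spohn_factored\<close>). For a singleton, the first factor
  does not vanish off the excluded hyperplanes, and the second one can be any function of the
  other slots that is affine in each of them (\<open>payoff_form_prod\<close>). A polynomial with degrees at most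
  \<open>d i\<close> is such a function of the slots \<open>(i, k)\<close> with \<open>k \<ge> 1\<close> once powers are written as products of
  copies. Hence the \<open>m \<le> n - l\<close> polynomials can be assigned to the singletons owning slots \<open>(i, 0)\<close>, and
  the remaining \<open>\<delta>\<close> singletons have just enough equations to make the copies equal. (An exception
  is \<open>d i = 1\<close>, where one copy is enough and the other slot is fixed instead.) For the
  members of a pair it is the second factor that does not vanish, and their two equations cut
  the 3-space down to a line, which carries one slot (\<open>exists_game\<close>). The common solutions off
  the hyperplanes are therefore the points of the graph of a polynomial map over \<open>S\<close>
  (\<open>slot_eq_solutions\<close>).

  Such a graph is isomorphic to \<open>S\<close> and closed in the chart (\<open>isomorphic_embedding\<close>,
  \<open>closure_of_embedding\<close>). It remains to see that the points of the graph off the excluded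
  hyperplanes are dense in it. This is where the translation by \<open>c\<close> enters: a coordinate is
  constant on a nonempty open part of \<open>S\<close> for at most countably many of its values, so that all but
  countably many translations move every such value away from the hyperplanes
  (\<open>generic_translation\<close>).
\<close>


section \<open>Polynomial functions and homogeneous fractions\<close>

lemma monomial_value_superset:
  assumes "finite A" "Poly_Mapping.keys m \<subseteq> A"
  shows "(\<Prod>i \<in> Poly_Mapping.keys m. (x i :: real) ^ Poly_Mapping.lookup m i) = (\<Prod>i \<in> A. x i ^ Poly_Mapping.lookup m i)"
  by (rule prod.mono_neutral_left) (use assms in \<open>auto simp: in_keys_iff\<close>)

lemma monomial_value_add:
  "(\<Prod>i \<in> Poly_Mapping.keys (m + m'). (x i :: real) ^ Poly_Mapping.lookup (m + m') i) =
   (\<Prod>i \<in> Poly_Mapping.keys m. x i ^ Poly_Mapping.lookup m i) *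
   (\<Prod>i \<in> Poly_Mapping.keys m'. x i ^ Poly_Mapping.lookup m' i)"
proof -
  let ?A = "Poly_Mapping.keys m \<union> Poly_Mapping.keys m'"
  have A: "finite ?A" "Poly_Mapping.keys (m + m') \<subseteq> ?A"
    by (auto dest: set_mp[OF Poly_Mapping.keys_add])
  show ?thesis
    by (subst (1 2 3) monomial_value_superset[of ?A])
       (use A in \<open>auto simp: lookup_add power_add prod.distrib\<close>)
qed

lemma peval_superset:
  assumes "finite A" "Poly_Mapping.keys P \<subseteq> A"
  shows "peval x P = (\<Sum>m \<in> A. Poly_Mapping.lookup P m *
     (\<Prod>i \<in> Poly_Mapping.keys m. x i ^ Poly_Mapping.lookup m i))"
  unfolding peval_def
  by (rule sum.mono_neutral_left) (use assms in \<open>auto simp: in_keys_iff\<close>)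

lemma peval_add: "peval x (P + Q) = peval x P + peval x Q"
proof -
  let ?A = "Poly_Mapping.keys P \<union> Poly_Mapping.keys Q"
  have A: "finite ?A" "Poly_Mapping.keys (P + Q) \<subseteq> ?A"
    by (auto dest: set_mp[OF Poly_Mapping.keys_add])
  show ?thesis
    by (subst (1 2 3) peval_superset[of ?A])
       (use A in \<open>auto simp: lookup_add distrib_right sum.distrib\<close>)
qed

lemma peval_single:
  "peval x (Poly_Mapping.single m a) = a * (\<Prod>i \<in> Poly_Mapping.keys m. x i ^ Poly_Mapping.lookup m i)"
  by (subst peval_superset[of "{m}"]) auto

lemma peval_0 [simp]: "peval x 0 = 0"
  by (simp add: peval_def)

lemma peval_sum: "peval x (\<Sum>k \<in> K. P k) = (\<Sum>k \<in> K. peval x (P k))"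
  by (induction K rule: infinite_finite_induct) (auto simp: peval_add)

lemma sum_monomials: "(\<Sum>m \<in> Poly_Mapping.keys P. Poly_Mapping.single m (Poly_Mapping.lookup P m)) = P"
  by (rule poly_mapping_eqI)
     (auto simp: lookup_sum lookup_single when_def in_keys_iff sum.delta)

lemma peval_mult: "peval x (P * Q) = peval x P * peval x Q"
proof -
  have "P * Q = (\<Sum>m \<in> Poly_Mapping.keys P. Poly_Mapping.single m (Poly_Mapping.lookup P m)) *
                (\<Sum>m \<in> Poly_Mapping.keys Q. Poly_Mapping.single m (Poly_Mapping.lookup Q m))"
    by (simp only: sum_monomials)
  also have "\<dots> = (\<Sum>m \<in> Poly_Mapping.keys P. \<Sum>m' \<in> Poly_Mapping.keys Q.
      Poly_Mapping.single (m + m') (Poly_Mapping.lookup P m * Poly_Mapping.lookup Q m'))"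
    by (simp add: sum_product mult_single)
  finally show ?thesis
    by (simp add: peval_sum peval_single monomial_value_add sum_product) 
       (simp add: peval_def sum_product mult_ac)
qed

lemma polys_add: "P \<in> polys I \<Longrightarrow> Q \<in> polys I \<Longrightarrow> P + Q \<in> polys I"
  unfolding polys_def using Poly_Mapping.keys_add[of P Q] by blast

lemma polys_mult:
  assumes "P \<in> polys I" "Q \<in> polys I" shows "P * Q \<in> polys I"
  unfolding polys_def
proof (safe)
  fix m i assume "m \<in> Poly_Mapping.keys (P * Q)" and i: "i \<in> Poly_Mapping.keys m"
  then obtain a b where "a \<in> Poly_Mapping.keys P" "b \<in> Poly_Mapping.keys Q" "m = a + b"
    using keys_mult[of P Q] by blast
  then show "i \<in> I"
    using assms i Poly_Mapping.keys_add[of a b] unfolding polys_def by blast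
qed

lemma const_in_polys: "Poly_Mapping.single 0 a \<in> polys I"
  by (auto simp: polys_def)

lemma var_in_polys: "i \<in> I \<Longrightarrow> Poly_Mapping.single (Poly_Mapping.single i (Suc 0)) a \<in> polys I"
  by (auto simp: polys_def split: if_splits)

lemma peval_const [simp]: "peval x (Poly_Mapping.single 0 a) = a"
  by (simp add: peval_single)

lemma peval_var [simp]: "peval x (Poly_Mapping.single (Poly_Mapping.single i (Suc 0)) a) = a * x i"
  by (simp add: peval_single)

lemma peval_cong:
  assumes "P \<in> polys I" "\<And>i. i \<in> I \<Longrightarrow> x i = y i"
  shows "peval x P = peval y P"
  unfolding peval_def
  by (intro sum.cong refl arg_cong2[where f = "(*)"] prod.cong) (use assms in \<open>auto simp: polys_def subset_iff\<close>)

text \<open>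
  Stated for an arbitrary class \<open>C\<close> of functions, because substitution into a polynomial occurs
  for polynomial functions, for fractions of forms and for continuous functions.
\<close>

lemma closed_under_peval:
  fixes C :: "('a \<Rightarrow> real) \<Rightarrow> bool"
  assumes const: "\<And>a. C (\<lambda>_. a)"
    and add: "\<And>f g. C f \<Longrightarrow> C g \<Longrightarrow> C (\<lambda>x. f x + g x)"
    and mult: "\<And>f g. C f \<Longrightarrow> C g \<Longrightarrow> C (\<lambda>x. f x * g x)"
    and P: "P \<in> polys I" and var: "\<And>i. i \<in> I \<Longrightarrow> C (\<lambda>x. \<phi> x i)"
  shows "C (\<lambda>x. peval (\<phi> x) P)"
proof -
  have power: "C (\<lambda>x. f x ^ k)" if "C f" for f and k :: nat
    by (induction k) (auto intro: const mult that)
  have prod: "C (\<lambda>x. \<Prod>i \<in> K. f i x)" if "\<And>i. i \<in> K \<Longrightarrow> C (f i)" for f :: "'b \<Rightarrow> _" and K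
    using that by (induction K rule: infinite_finite_induct) (auto intro: const mult)
  have sum: "C (\<lambda>x. \<Sum>i \<in> K. f i x)" if "\<And>i. i \<in> K \<Longrightarrow> C (f i)" for f :: "('b \<Rightarrow>\<^sub>0 nat) \<Rightarrow> _" and K
    using that by (induction K rule: infinite_finite_induct) (auto intro: const add)
  show ?thesis unfolding peval_def
    by (intro sum mult const prod power var) (use P in \<open>auto simp: polys_def\<close>)
qed

definition poly_fun :: "'v set \<Rightarrow> (('v \<Rightarrow> real) \<Rightarrow> real) \<Rightarrow> bool" where
  "poly_fun I f \<longleftrightarrow> (\<exists>P \<in> polys I. \<forall>x. f x = peval x P)"

lemma poly_fun_const: "poly_fun I (\<lambda>_. a)"
  unfolding poly_fun_def by (intro bexI[OF _ const_in_polys]) simp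

lemma poly_fun_var: "i \<in> I \<Longrightarrow> poly_fun I (\<lambda>x. x i)"
  unfolding poly_fun_def by (intro bexI[OF _ var_in_polys[of i I 1]]) simp_all

lemma poly_fun_add: "poly_fun I f \<Longrightarrow> poly_fun I g \<Longrightarrow> poly_fun I (\<lambda>x. f x + g x)"
  unfolding poly_fun_def by (metis polys_add peval_add)

lemma poly_fun_mult: "poly_fun I f \<Longrightarrow> poly_fun I g \<Longrightarrow> poly_fun I (\<lambda>x. f x * g x)"
  unfolding poly_fun_def by (metis polys_mult peval_mult)

lemma poly_fun_diff: "poly_fun I f \<Longrightarrow> poly_fun I g \<Longrightarrow> poly_fun I (\<lambda>x. f x - g x)"
  using poly_fun_add[of I f "\<lambda>x. (-1) * g x"] poly_fun_mult[OF poly_fun_const[of I "-1"], of g]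
  by simp

lemma poly_fun_prod:
  "(\<And>k. k \<in> K \<Longrightarrow> poly_fun I (f k)) \<Longrightarrow> poly_fun I (\<lambda>x. \<Prod>k \<in> K. f k x)"
  by (induction K rule: infinite_finite_induct) (auto intro: poly_fun_const poly_fun_mult)

lemma poly_fun_peval:
  "P \<in> polys J \<Longrightarrow> (\<And>j. j \<in> J \<Longrightarrow> poly_fun I (\<lambda>x. \<phi> x j)) \<Longrightarrow> poly_fun I (\<lambda>x. peval (\<phi> x) P)"
  by (rule closed_under_peval[where C = "poly_fun I"])
     (auto intro: poly_fun_const poly_fun_add poly_fun_mult)

lemma homogeneous_const: "homogeneous 0 (Poly_Mapping.single 0 a)"
  by (auto simp: homogeneous_def)

lemma homogeneous_var: "homogeneous (Suc 0) (Poly_Mapping.single (Poly_Mapping.single i (Suc 0)) a)"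
  by (auto simp: homogeneous_def split: if_splits)

lemma homogeneous_add: "homogeneous d P \<Longrightarrow> homogeneous d Q \<Longrightarrow> homogeneous d (P + Q)"
  unfolding homogeneous_def using Poly_Mapping.keys_add[of P Q] by blast

lemma homogeneous_mult:
  assumes "homogeneous d P" "homogeneous e Q" shows "homogeneous (d + e) (P * Q)"
  unfolding homogeneous_def
proof
  fix m assume "m \<in> Poly_Mapping.keys (P * Q)"
  then obtain a b where ab: "a \<in> Poly_Mapping.keys P" "b \<in> Poly_Mapping.keys Q" "m = a + b"
    using keys_mult[of P Q] by blast
  let ?A = "Poly_Mapping.keys a \<union> Poly_Mapping.keys b"
  have deg: "(\<Sum>i \<in> Poly_Mapping.keys m'. Poly_Mapping.lookup m' i) = (\<Sum>i \<in> ?A. Poly_Mapping.lookup m' i)"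
    if "Poly_Mapping.keys m' \<subseteq> ?A" for m'
    by (rule sum.mono_neutral_left) (use that in \<open>auto simp: in_keys_iff\<close>)
  show "(\<Sum>i \<in> Poly_Mapping.keys m. Poly_Mapping.lookup m i) = d + e"
    using assms ab deg[of a] deg[of b] deg[of m] Poly_Mapping.keys_add[of a b]
    by (auto simp: homogeneous_def lookup_add sum.distrib)
qed

lemma peval_scale:
  assumes "homogeneous d P" "P \<in> polys J" "\<And>j. j \<in> J \<Longrightarrow> w j = c * v j"
  shows "peval w P = c ^ d * peval v P"
proof -
  have "(\<Prod>i \<in> Poly_Mapping.keys m. w i ^ Poly_Mapping.lookup m i) =
      c ^ d * (\<Prod>i \<in> Poly_Mapping.keys m. v i ^ Poly_Mapping.lookup m i)"
    if m: "m \<in> Poly_Mapping.keys P" for m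
  proof -
    have "(\<Prod>i \<in> Poly_Mapping.keys m. w i ^ Poly_Mapping.lookup m i) =
       (\<Prod>i \<in> Poly_Mapping.keys m. (c * v i) ^ Poly_Mapping.lookup m i)"
      by (rule prod.cong) (use m assms(2,3) in \<open>auto simp: polys_def subset_iff\<close>)
    also have "\<dots> = c ^ (\<Sum>i \<in> Poly_Mapping.keys m. Poly_Mapping.lookup m i) *
       (\<Prod>i \<in> Poly_Mapping.keys m. v i ^ Poly_Mapping.lookup m i)"
      by (simp add: power_mult_distrib prod.distrib power_sum)
    finally show ?thesis using m assms(1) by (simp add: homogeneous_def)
  qed
  then show ?thesis
    unfolding peval_def by (simp add: sum_distrib_left mult_ac)
qed

text \<open>
  The polynomials in the affine coordinates \<open>v j / v z\<close> of a chart of projective space. Fixing the denominator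
  to be a power of one coordinate makes closure under sums and products immediate.
\<close>

definition homog_frac :: "'v set \<Rightarrow> 'v \<Rightarrow> (('v \<Rightarrow> real) \<Rightarrow> real) \<Rightarrow> bool" where
  "homog_frac J z f \<longleftrightarrow> (\<exists>d P. P \<in> polys J \<and> homogeneous d P \<and>
     (\<forall>v. v z \<noteq> 0 \<longrightarrow> f v = peval v P / v z ^ d))"

definition power_form :: "'v \<Rightarrow> nat \<Rightarrow> 'v rpoly" where
  "power_form z d = Poly_Mapping.single (Poly_Mapping.single z (Suc 0)) 1 ^ d"

lemma power_form:
  assumes "z \<in> J"
  shows "power_form z d \<in> polys J" "homogeneous d (power_form z d)"
    "peval v (power_form z d) = v z ^ d"
proof -
  show "power_form z d \<in> polys J" 
    using const_in_polys[of 1 J]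
    by (induction d) (auto simp: power_form_def intro!: polys_mult var_in_polys assms)
  show "homogeneous d (power_form z d)"
  proof (induction d)
    case 0
    then show ?case using homogeneous_const[of 1] by (simp add: power_form_def)
  next
    case (Suc d)
    then show ?case using homogeneous_mult[OF homogeneous_var[of z 1] Suc] by (simp add: power_form_def)
  qed
  show "peval v (power_form z d) = v z ^ d"
  proof (induction d)
    case 0
    then show ?case using peval_const[of v 1] by (simp add: power_form_def del: peval_const)
  next
    case (Suc d)
    then show ?case by (simp add: power_form_def peval_mult )
  qed
qed

lemma homog_frac_const: "homog_frac J z (\<lambda>_. a)"
  unfolding homog_frac_def using const_in_polys homogeneous_const
  by (metis peval_const div_by_1 power_0)

lemma homog_frac_var: "j \<in> J \<Longrightarrow> homog_frac J z (\<lambda>v. v j / v z)"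
  unfolding homog_frac_def
  by (rule exI[of _ 1], rule exI[of _ "Poly_Mapping.single (Poly_Mapping.single j (Suc 0)) 1"])
     (use var_in_polys homogeneous_var in auto)

lemma homog_frac_mult:
  assumes "homog_frac J z f" "homog_frac J z g"
  shows "homog_frac J z (\<lambda>v. f v * g v)"
proof -
  from assms obtain d P e Q where
    "P \<in> polys J" "homogeneous d P" "\<And>v. v z \<noteq> 0 \<Longrightarrow> f v = peval v P / v z ^ d"
    "Q \<in> polys J" "homogeneous e Q" "\<And>v. v z \<noteq> 0 \<Longrightarrow> g v = peval v Q / v z ^ e"
    unfolding homog_frac_def by metis
  then show ?thesis unfolding homog_frac_def
    by (intro exI[of _ "d + e"] exI[of _ "P * Q"])
       (auto simp: polys_mult homogeneous_mult peval_mult power_add)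
qed

lemma homog_frac_add:
  assumes "homog_frac J z f" "homog_frac J z g" "z \<in> J"
  shows "homog_frac J z (\<lambda>v. f v + g v)"
proof -
  from assms obtain d P e Q where *:
    "P \<in> polys J" "homogeneous d P" "\<And>v. v z \<noteq> 0 \<Longrightarrow> f v = peval v P / v z ^ d"
    "Q \<in> polys J" "homogeneous e Q" "\<And>v. v z \<noteq> 0 \<Longrightarrow> g v = peval v Q / v z ^ e"
    unfolding homog_frac_def by metis
  have "homogeneous (d + e) (P * power_form z e + Q * power_form z d)"
    using homogeneous_mult[OF *(2) power_form(2)[OF assms(3), of e]]
      homogeneous_mult[OF *(5) power_form(2)[OF assms(3), of d]]
    by (auto intro!: homogeneous_add simp: add.commute)
  with * show ?thesis unfolding homog_frac_def
    by (intro exI[of _ "d + e"] exI[of _ "P * power_form z e + Q * power_form z d"])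
       (auto intro!: polys_add polys_mult power_form assms(3)
         simp: peval_add peval_mult power_form(3)[OF assms(3)] power_add field_simps)
qed

lemma homog_frac_peval:
  assumes "P \<in> polys I" "z \<in> J" "\<And>i. i \<in> I \<Longrightarrow> homog_frac J z (\<lambda>v. \<psi> v i)"
  shows "homog_frac J z (\<lambda>v. peval (\<psi> v) P)"
  by (rule closed_under_peval[where C = "homog_frac J z"])
     (use assms in \<open>auto intro: homog_frac_const homog_frac_add homog_frac_mult\<close>)


section \<open>Zariski topologies\<close>

lemma topspace_zariski_affine [simp]: "topspace (zariski_affine I) = affine_space I"
proof -
  have "affine_space I \<in> {{x \<in> affine_space I. peval x P \<noteq> 0} | P. P \<in> polys I}"
    by (rule CollectI, rule exI[of _ "Poly_Mapping.single 0 1"])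
       (simp add: const_in_polys del: single_one)
  then show ?thesis
    unfolding zariski_affine_def topology_generated_by_topspace by blast
qed

lemma topspace_zariski_proj [simp]: "topspace (zariski_proj J) = proj_space J"
proof -
  have "proj_space J \<in> {{x \<in> proj_space J. \<forall>v \<in> x. peval v P \<noteq> 0} | P. P \<in> polys J \<and> (\<exists>d. homogeneous d P)}"
    by (rule CollectI, rule exI[of _ "Poly_Mapping.single 0 1"])
       (use homogeneous_const in \<open>auto simp: const_in_polys simp del: single_one\<close>)
  then show ?thesis
    unfolding zariski_proj_def topology_generated_by_topspace by blast
qed

lemma openin_zariski_affine_basic:
  "P \<in> polys I \<Longrightarrow> openin (zariski_affine I) {x \<in> affine_space I. peval x P \<noteq> 0}"
  unfolding zariski_affine_def by (rule topology_generated_by_Basis) blast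

lemma openin_zariski_proj_basic:
  "P \<in> polys J \<Longrightarrow> homogeneous d P \<Longrightarrow>
   openin (zariski_proj J) {x \<in> proj_space J. \<forall>v \<in> x. peval v P \<noteq> 0}"
  unfolding zariski_proj_def by (rule topology_generated_by_Basis) blast

lemma proj_point_self: "restrict v J \<in> proj_point J v"
  by (auto simp: proj_point_def affine_space_def intro!: exI[of _ 1])

lemma proj_pointE:
  assumes "w \<in> proj_point J v"
  obtains c where "c \<noteq> 0" "\<And>j. j \<in> J \<Longrightarrow> w j = c * v j"
  using assms by (auto simp: proj_point_def)

lemma proj_point_eqI:
  assumes "c \<noteq> 0" "\<And>j. j \<in> J \<Longrightarrow> w j = c * v j"
  shows "proj_point J w = proj_point J v"
proof -
  have "(\<exists>a. a \<noteq> 0 \<and> (\<forall>j\<in>J. u j = a * w j)) \<longleftrightarrow> (\<exists>b. b \<noteq> 0 \<and> (\<forall>j\<in>J. u j = b * v j))" for u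
  proof
    assume "\<exists>a. a \<noteq> 0 \<and> (\<forall>j\<in>J. u j = a * w j)"
    then obtain a where "a \<noteq> 0" "\<forall>j\<in>J. u j = a * w j" by blast
    with assms show "\<exists>b. b \<noteq> 0 \<and> (\<forall>j\<in>J. u j = b * v j)" by (intro exI[of _ "a * c"]) auto
  next
    assume "\<exists>b. b \<noteq> 0 \<and> (\<forall>j\<in>J. u j = b * v j)"
    then obtain b where "b \<noteq> 0" "\<forall>j\<in>J. u j = b * v j" by blast
    with assms show "\<exists>a. a \<noteq> 0 \<and> (\<forall>j\<in>J. u j = a * w j)" by (intro exI[of _ "b / c"]) auto
  qed
  then show ?thesis unfolding proj_point_def by simp
qed

lemma proj_point_in_proj_space:
  assumes "j \<in> J" "v j \<noteq> 0" shows "proj_point J v \<in> proj_space J"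
proof -
  have "proj_point J v = proj_point J (restrict v J)"
    by (rule proj_point_eqI[of 1]) auto
  moreover have "restrict v J \<in> affine_space J" by (simp add: affine_space_def)
  moreover have "restrict v J j \<noteq> 0" using assms by simp
  ultimately show ?thesis using assms(1) unfolding proj_space_def by blast
qed

lemma peval_nonzero_on_proj_point:
  assumes "P \<in> polys J" "homogeneous d P"
  shows "(\<forall>w \<in> proj_point J v. peval w P \<noteq> 0) \<longleftrightarrow> peval v P \<noteq> 0"
proof
  assume "\<forall>w \<in> proj_point J v. peval w P \<noteq> 0"
  with proj_point_self[of v J] have "peval (restrict v J) P \<noteq> 0" by blast
  moreover have "peval (restrict v J) P = peval v P"
    by (rule peval_cong[OF assms(1)]) simp
  ultimately show "peval v P \<noteq> 0" by simp
next
  assume "peval v P \<noteq> 0"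
  then show "\<forall>w \<in> proj_point J v. peval w P \<noteq> 0"
  proof (intro ballI)
    fix w assume "w \<in> proj_point J v"
    then obtain c where "c \<noteq> 0" "\<And>j. j \<in> J \<Longrightarrow> w j = c * v j" by (rule proj_pointE) blast
    then show "peval w P \<noteq> 0"
      using peval_scale[OF assms(2,1), of w c v] \<open>peval v P \<noteq> 0\<close> by simp
  qed
qed


section \<open>Varieties that are graphs over affine space\<close>

text \<open>
  The map \<open>\<phi>\<close> sends a point of affine space to homogeneous coordinates, one of which, at
  \<open>z\<close>, is normalised to 1; up to the translation by \<open>c\<close> every affine coordinate is
  again one of the homogeneous coordinates. So the projective points \<open>\<phi> x\<close> form a graph
  over affine space, and both directions of the correspondence are given by polynomials.
\<close>

locale polynomial_graph =
  fixes I :: "'i set" and J :: "'j set" and \<phi> :: "('i \<Rightarrow> real) \<Rightarrow> 'j \<Rightarrow> real"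
    and z :: 'j and coord :: "'i \<Rightarrow> 'j" and c :: "'i \<Rightarrow> real"
  assumes z: "z \<in> J" and \<phi>_z: "\<phi> x z = 1"
    and poly_\<phi>: "j \<in> J \<Longrightarrow> poly_fun I (\<lambda>x. \<phi> x j)"
    and coord: "i \<in> I \<Longrightarrow> coord i \<in> J"
    and \<phi>_coord: "i \<in> I \<Longrightarrow> \<phi> x (coord i) = x i - c i"
begin

definition embed :: "('i \<Rightarrow> real) \<Rightarrow> ('j \<Rightarrow> real) set" where
  "embed x = proj_point J (\<phi> x)"

definition read :: "('j \<Rightarrow> real) \<Rightarrow> 'i \<Rightarrow> real" where
  "read v = (\<lambda>i \<in> I. c i + v (coord i) / v z)"

definition project :: "('j \<Rightarrow> real) set \<Rightarrow> 'i \<Rightarrow> real" where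
  "project q = read (SOME v. v \<in> q)"

lemma embed_in_proj_space: "embed x \<in> proj_space J"
  unfolding embed_def by (rule proj_point_in_proj_space[OF z]) (simp add: \<phi>_z)

lemma embedE:
  assumes "v \<in> embed x"
  obtains "v z \<noteq> 0" "\<And>j. j \<in> J \<Longrightarrow> v j / v z = \<phi> x j"
proof -
  obtain k where k: "k \<noteq> 0" "\<And>j. j \<in> J \<Longrightarrow> v j = k * \<phi> x j"
    using assms unfolding embed_def by (rule proj_pointE) blast
  from k(2)[OF z] have "v z = k" by (simp add: \<phi>_z)
  with k that show ?thesis by simp
qed

lemma read_in_affine_space: "read v \<in> affine_space I"
  by (simp add: read_def affine_space_def)

lemma read_embed:
  assumes "v \<in> embed x" "x \<in> affine_space I" shows "read v = x"
proof
  fix i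
  show "read v i = x i"
  proof (cases "i \<in> I")
    case True
    obtain "v (coord i) / v z = \<phi> x (coord i)"
      using embedE[OF assms(1)] coord[OF True] by metis
    then show ?thesis using True by (simp add: read_def \<phi>_coord)
  next
    case False
    then show ?thesis using assms(2) by (simp add: read_def affine_space_def PiE_arb[where x = i])
  qed
qed

lemma embed_nonempty: "embed x \<noteq> {}"
  unfolding embed_def using proj_point_self by blast

lemma project_embed: "x \<in> affine_space I \<Longrightarrow> project (embed x) = x"
  unfolding project_def by (rule read_embed[OF some_in_eq[THEN iffD2, OF embed_nonempty]])

lemma homog_frac_read:
  assumes "P \<in> polys I" shows "homog_frac J z (\<lambda>v. peval (read v) P)"
  by (rule homog_frac_peval[OF assms z])
     (auto simp: read_def intro!: homog_frac_add homog_frac_const homog_frac_var coord z)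

lemma peval_substituted:
  assumes "P \<in> polys J"
  obtains R where "R \<in> polys I" "\<And>x. peval (\<phi> x) P = peval x R"
proof -
  have "poly_fun I (\<lambda>x. peval (\<phi> x) P)" by (rule poly_fun_peval[OF assms poly_\<phi>])
  then show ?thesis using that unfolding poly_fun_def by blast
qed

lemma continuous_embed: "continuous_map (zariski_affine I) (zariski_proj J) embed"
  unfolding zariski_proj_def
proof (rule continuous_on_generated_topo, safe)
  fix P d assume P: "P \<in> polys J" "homogeneous d P"
  obtain R where R: "R \<in> polys I" "\<And>x. peval (\<phi> x) P = peval x R"
    using peval_substituted[OF P(1)] by blast
  have "embed -` {x \<in> proj_space J. \<forall>v\<in>x. peval v P \<noteq> 0} \<inter> topspace (zariski_affine I)
    = {x \<in> affine_space I. peval x R \<noteq> 0}"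
  proof (intro set_eqI)
    fix x
    have "(\<forall>v\<in>embed x. peval v P \<noteq> 0) \<longleftrightarrow> peval x R \<noteq> 0"
      unfolding embed_def R(2)[symmetric] by (rule peval_nonzero_on_proj_point[OF P])
    then show "x \<in> embed -` {x \<in> proj_space J. \<forall>v\<in>x. peval v P \<noteq> 0} \<inter> topspace (zariski_affine I)
      \<longleftrightarrow> x \<in> {x \<in> affine_space I. peval x R \<noteq> 0}"
      using embed_in_proj_space[of x] by (simp add: conj_commute)
  qed
  then show "openin (zariski_affine I)
      (embed -` {x \<in> proj_space J. \<forall>v\<in>x. peval v P \<noteq> 0} \<inter> topspace (zariski_affine I))"
    using openin_zariski_affine_basic[OF R(1)] by simp
next
  fix x
  have "embed x \<in> topspace (zariski_proj J)" by (simp add: embed_in_proj_space)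
  then show "embed x \<in> \<Union> {{x \<in> proj_space J. \<forall>v\<in>x. peval v P \<noteq> 0} |P. P \<in> polys J \<and> (\<exists>d. homogeneous d P)}"
    unfolding zariski_proj_def by simp
qed

lemma continuous_project:
  assumes U: "U \<subseteq> embed ` affine_space I"
  shows "continuous_map (subtopology (zariski_proj J) U) (zariski_affine I) project"
  unfolding zariski_affine_def
proof (rule continuous_on_generated_topo, safe)
  fix P assume P: "P \<in> polys I"
  obtain d R where R: "R \<in> polys J" "homogeneous d R"
      "\<And>v. v z \<noteq> 0 \<Longrightarrow> peval (read v) P = peval v R / v z ^ d"
    using homog_frac_read[OF P] unfolding homog_frac_def by metis
  have *: "peval x P \<noteq> 0 \<longleftrightarrow> (\<forall>v \<in> embed x. peval v R \<noteq> 0)" if "x \<in> affine_space I" for x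
  proof -
    have "peval v R \<noteq> 0 \<longleftrightarrow> peval x P \<noteq> 0" if "v \<in> embed x" for v
      using R(3)[of v] read_embed[OF that \<open>x \<in> _\<close>] that by (auto elim!: embedE)
    then show ?thesis using embed_nonempty by blast
  qed
  have "project -` {x \<in> affine_space I. peval x P \<noteq> 0} \<inter> topspace (subtopology (zariski_proj J) U)
    = {q \<in> proj_space J. \<forall>v\<in>q. peval v R \<noteq> 0} \<inter> U"
  proof (intro set_eqI)
    fix q
    show "q \<in> project -` {x \<in> affine_space I. peval x P \<noteq> 0} \<inter> topspace (subtopology (zariski_proj J) U) \<longleftrightarrow>
        q \<in> {q \<in> proj_space J. \<forall>v\<in>q. peval v R \<noteq> 0} \<inter> U"
    proof (cases "q \<in> U")
      case True
      then obtain x where x: "x \<in> affine_space I" "q = embed x" using U by blast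
      then show ?thesis using *[OF x(1)] True embed_in_proj_space[of x] by (simp add: project_embed)
    qed simp
  qed
  then show "openin (subtopology (zariski_proj J) U)
      (project -` {x \<in> affine_space I. peval x P \<noteq> 0} \<inter> topspace (subtopology (zariski_proj J) U))"
    using openin_zariski_proj_basic[OF R(1,2)] by (auto simp: openin_subtopology)
next
  fix q
  have "project q \<in> topspace (zariski_affine I)" by (simp add: project_def read_in_affine_space)
  then show "project q \<in> \<Union> {{x \<in> affine_space I. peval x P \<noteq> 0} |P. P \<in> polys I}"
    unfolding zariski_affine_def by simp
qed

text \<open>
  Regular functions are pulled back by substitution: of \<open>\<phi>\<close> in one direction, and of the
  affine coordinates \<open>read\<close>, followed by homogenisation, in the other.
\<close>

theorem isomorphic_embedding:
  assumes S: "S \<subseteq> affine_space I"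
  shows "isomorphic_varieties (quasiproj_variety J (embed ` S)) (affine_variety I S)"
proof -
  let ?A = "quasiproj_variety J (embed ` S)" and ?B = "affine_variety I S"
  have topA: "zariski ?A = subtopology (zariski_proj J) (embed ` S)"
    and topB: "zariski ?B = subtopology (zariski_affine I) S"
    by (simp_all add: quasiproj_variety_def affine_variety_def)
  have spaceA: "topspace (zariski ?A) = embed ` S"
    using embed_in_proj_space by (auto simp: topA)
  have spaceB: "topspace (zariski ?B) = S" using S by (auto simp: topB)
  have contA: "continuous_map (zariski ?A) (zariski ?B) project"
    unfolding topA topB
    by (rule continuous_map_into_subtopology[OF continuous_project])
       (use S in \<open>auto simp: project_embed subset_iff image_iff\<close>)
  have contB: "continuous_map (zariski ?B) (zariski ?A) embed"
    unfolding topA topB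
    by (rule continuous_map_into_subtopology[OF continuous_map_from_subtopology[OF continuous_embed]]) auto
  have "morphism ?A ?B project"
    unfolding morphism_def
  proof (intro conjI contA allI impI)
    fix V h assume V: "openin (zariski ?B) V \<and> h \<in> regular ?B V"
    have "\<exists>W P Q d. openin (zariski ?A) W \<and> q \<in> W \<and> W \<subseteq> {q \<in> embed ` S. project q \<in> V} \<and>
        P \<in> polys J \<and> Q \<in> polys J \<and> homogeneous d P \<and> homogeneous d Q \<and>
        (\<forall>y \<in> W. \<forall>v \<in> y. peval v Q \<noteq> 0 \<and> (h \<circ> project) y = peval v P / peval v Q)"
      if "q \<in> embed ` S" and q: "project q \<in> V" for q
    proof -
      from V q obtain W P Q where W: "openin (zariski ?B) W" "project q \<in> W" "W \<subseteq> V"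
        and PQ: "P \<in> polys I" "Q \<in> polys I" "\<And>y. y \<in> W \<Longrightarrow> peval y Q \<noteq> 0 \<and> h y = peval y P / peval y Q"
        by (elim conjE, simp add: affine_variety_def) meson
      obtain d P' where P': "P' \<in> polys J" "homogeneous d P'"
          "\<And>v. v z \<noteq> 0 \<Longrightarrow> peval (read v) P = peval v P' / v z ^ d"
        using homog_frac_read[OF PQ(1)] unfolding homog_frac_def by metis
      obtain e Q' where Q': "Q' \<in> polys J" "homogeneous e Q'"
          "\<And>v. v z \<noteq> 0 \<Longrightarrow> peval (read v) Q = peval v Q' / v z ^ e"
        using homog_frac_read[OF PQ(2)] unfolding homog_frac_def by metis
      let ?W = "{q \<in> topspace (zariski ?A). project q \<in> W}"
      \<comment> \<open>The two forms may have different degrees; cross multiplication makes them equal.\<close>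
      let ?P = "P' * power_form z e" and ?Q = "Q' * power_form z d"
      have "\<forall>y \<in> ?W. \<forall>v \<in> y. peval v ?Q \<noteq> 0 \<and> (h \<circ> project) y = peval v ?P / peval v ?Q"
      proof (intro ballI)
        fix y v assume y: "y \<in> ?W" and v: "v \<in> y"
        from y spaceA obtain x where x: "x \<in> S" "y = embed x" by auto
        with S have xa: "x \<in> affine_space I" by blast
        with x y v have "x \<in> W" "read v = x" by (auto simp: project_embed read_embed)
        moreover have "v z \<noteq> 0" using v x by (auto elim: embedE)
        ultimately show "peval v ?Q \<noteq> 0 \<and> (h \<circ> project) y = peval v ?P / peval v ?Q"
          using PQ(3)[of x] P'(3)[of v] Q'(3)[of v] x xa
          by (auto simp: project_embed peval_mult power_form(3)[OF z] field_simps)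
      qed
      moreover have "openin (zariski ?A) ?W"
        by (rule openin_continuous_map_preimage[OF contA W(1)])
      moreover have "homogeneous (d + e) ?P" "homogeneous (d + e) ?Q"
        using homogeneous_mult[OF P'(2) power_form(2)[OF z, of e]]
          homogeneous_mult[OF Q'(2) power_form(2)[OF z, of d]] by (simp_all add: add.commute)
      moreover have "?P \<in> polys J" "?Q \<in> polys J"
        by (auto intro!: polys_mult P' Q' power_form z)
      moreover have "q \<in> ?W" "?W \<subseteq> {q \<in> embed ` S. project q \<in> V}"
        using that W spaceA by auto
      ultimately show ?thesis
        by (intro exI[of _ ?W] exI[of _ ?P] exI[of _ ?Q] exI[of _ "d + e"] conjI)
    qed
    then show "h \<circ> project \<in> regular ?A {x \<in> topspace (zariski ?A). project x \<in> V}"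
      unfolding spaceA by (simp add: quasiproj_variety_def)
  qed
  moreover have "morphism ?B ?A embed"
    unfolding morphism_def
  proof (intro conjI contB allI impI)
    fix V h assume V: "openin (zariski ?A) V \<and> h \<in> regular ?A V"
    have "\<exists>W P Q. openin (zariski ?B) W \<and> x \<in> W \<and> W \<subseteq> {x \<in> S. embed x \<in> V} \<and>
        P \<in> polys I \<and> Q \<in> polys I \<and>
        (\<forall>y \<in> W. peval y Q \<noteq> 0 \<and> (h \<circ> embed) y = peval y P / peval y Q)"
      if "x \<in> S" and x: "embed x \<in> V" for x
    proof -
      from V x obtain W P Q d where W: "openin (zariski ?A) W" "embed x \<in> W" "W \<subseteq> V"
        and PQ: "P \<in> polys J" "Q \<in> polys J" 
          "\<And>y v. y \<in> W \<Longrightarrow> v \<in> y \<Longrightarrow> peval v Q \<noteq> 0 \<and> h y = peval v P / peval v Q"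
        by (elim conjE, simp add: quasiproj_variety_def) meson
      obtain P' where P': "P' \<in> polys I" "\<And>x. peval (\<phi> x) P = peval x P'"
        using peval_substituted[OF PQ(1)] by blast
      obtain Q' where Q': "Q' \<in> polys I" "\<And>x. peval (\<phi> x) Q = peval x Q'"
        using peval_substituted[OF PQ(2)] by blast
      let ?W = "{x \<in> topspace (zariski ?B). embed x \<in> W}"
      have "\<forall>y \<in> ?W. peval y Q' \<noteq> 0 \<and> (h \<circ> embed) y = peval y P' / peval y Q'"
      proof
        fix y assume y: "y \<in> ?W"
        have "restrict (\<phi> y) J \<in> embed y" unfolding embed_def by (rule proj_point_self)
        moreover have "peval (restrict (\<phi> y) J) P = peval y P'" "peval (restrict (\<phi> y) J) Q = peval y Q'"
          using peval_cong[OF PQ(1), of "restrict (\<phi> y) J" "\<phi> y"]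
            peval_cong[OF PQ(2), of "restrict (\<phi> y) J" "\<phi> y"] P'(2) Q'(2) by auto
        ultimately show "peval y Q' \<noteq> 0 \<and> (h \<circ> embed) y = peval y P' / peval y Q'"
          using y PQ(3)[of "embed y" "restrict (\<phi> y) J"] by auto
      qed
      moreover have "openin (zariski ?B) ?W"
        by (rule openin_continuous_map_preimage[OF contB W(1)])
      moreover have "x \<in> ?W" "?W \<subseteq> {x \<in> S. embed x \<in> V}" using that W spaceB by auto
      ultimately show ?thesis
        using P'(1) Q'(1) by (intro exI[of _ ?W] exI[of _ P'] exI[of _ Q'] conjI)
    qed
    then show "h \<circ> embed \<in> regular ?B {x \<in> topspace (zariski ?B). embed x \<in> V}"
      unfolding spaceB by (simp add: affine_variety_def)
  qed
  moreover have "\<forall>x \<in> topspace (zariski ?A). embed (project x) = x"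
    using S unfolding spaceA by (auto simp: project_embed subset_iff)
  moreover have "\<forall>y \<in> topspace (zariski ?B). project (embed y) = y"
    using S unfolding spaceB by (auto simp: project_embed subset_iff)
  ultimately show ?thesis unfolding isomorphic_varieties_def by blast
qed

text \<open>
  The numerator of the fraction is a form, so its being nonzero is an open condition on
  projective points, and an open set that misses \<open>A\<close> misses the closure of \<open>A\<close>.
\<close>

lemma homog_frac_zero_on_closure:
  assumes f: "homog_frac J z f" and A: "\<And>q v. q \<in> A \<Longrightarrow> v \<in> q \<Longrightarrow> v z \<noteq> 0 \<and> f v = 0"
    and q: "proj_point J u \<in> zariski_proj J closure_of A" and u: "u z \<noteq> 0"
  shows "f u = 0"
proof (rule ccontr)
  assume "f u \<noteq> 0"
  obtain d P where P: "P \<in> polys J" "homogeneous d P" "\<And>v. v z \<noteq> 0 \<Longrightarrow> f v = peval v P / v z ^ d"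
    using f unfolding homog_frac_def by metis
  let ?T = "{q \<in> proj_space J. \<forall>v\<in>q. peval v P \<noteq> 0}"
  have "peval u P \<noteq> 0" using P(3)[of u] u \<open>f u \<noteq> 0\<close> by auto
  then have "proj_point J u \<in> ?T"
    using peval_nonzero_on_proj_point[OF P(1,2), of u] proj_point_in_proj_space[where v = u, OF z u] by simp
  then obtain q where "q \<in> A" "q \<in> ?T"
    using in_closure_of[THEN iffD1, OF q] openin_zariski_proj_basic[OF P(1,2)] by meson
  moreover obtain w where "q = proj_point J w"
    using \<open>q \<in> ?T\<close> unfolding proj_space_def by blast
  then obtain v where "v \<in> q"
    using proj_point_self by metis
  ultimately show False using A[of q v] P(3)[of v] by auto
qed

text \<open>
  The equations of \<open>S\<close> and the condition of lying on the graph of \<open>\<phi>\<close> are both fractions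
  of forms. They survive the passage to the closure, so within the chart nothing is added to
  the graph; and continuity of \<open>embed\<close> shows that no point of the graph is missed.
\<close>

theorem closure_of_embedding:
  assumes F: "F \<subseteq> polys I" and S0: "S0 \<subseteq> zero_locus I F"
    and dense: "\<And>T x. openin (zariski_affine I) T \<Longrightarrow> x \<in> T \<Longrightarrow> x \<in> zero_locus I F \<Longrightarrow> T \<inter> S0 \<noteq> {}"
    and u: "u z \<noteq> 0"
  shows "proj_point J u \<in> zariski_proj J closure_of (embed ` S0) \<longleftrightarrow>
    proj_point J u \<in> embed ` zero_locus I F"
proof
  assume cl: "proj_point J u \<in> zariski_proj J closure_of (embed ` S0)"
  have S0a: "S0 \<subseteq> affine_space I" using S0 by (auto simp: zero_locus_def)
  have "peval (read u) P = 0" if "P \<in> F" for P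
  proof (rule homog_frac_zero_on_closure[OF homog_frac_read _ cl u])
    show "P \<in> polys I" using F that by blast
    fix q v assume "q \<in> embed ` S0" "v \<in> q"
    then obtain x where x: "x \<in> S0" "v \<in> embed x" by blast
    then have "read v = x" using S0a by (intro read_embed) auto
    moreover have "v z \<noteq> 0" using x(2) by (auto elim: embedE)
    ultimately show "v z \<noteq> 0 \<and> peval (read v) P = 0"
      using x(1) S0 that by (auto simp: zero_locus_def)
  qed
  then have "read u \<in> zero_locus I F" by (simp add: zero_locus_def read_in_affine_space)
  moreover have "u j / u z - \<phi> (read u) j = 0" if j: "j \<in> J" for j
  proof (rule homog_frac_zero_on_closure[OF _ _ cl u])
    obtain R where R: "R \<in> polys I" "\<And>x. \<phi> x j = peval x R"
      using poly_\<phi>[OF j] unfolding poly_fun_def by metis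
    have "homog_frac J z (\<lambda>v. v j / v z + (-1) * peval (read v) R)"
      by (intro homog_frac_add homog_frac_mult homog_frac_const homog_frac_var homog_frac_read R z j)
    then show "homog_frac J z (\<lambda>v. v j / v z - \<phi> (read v) j)" by (simp add: R(2))
    fix q v assume "q \<in> embed ` S0" "v \<in> q"
    then obtain x where x: "x \<in> S0" "v \<in> embed x" by blast
    then have "read v = x" using S0a by (intro read_embed) auto
    moreover have "v z \<noteq> 0" "v j / v z = \<phi> x j" using x(2) j by (auto elim: embedE)
    ultimately show "v z \<noteq> 0 \<and> v j / v z - \<phi> (read v) j = 0" by simp
  qed
  then have "proj_point J u = embed (read u)"
    unfolding embed_def by (intro proj_point_eqI[OF u]) (use u in \<open>auto simp: field_simps\<close>)
  ultimately show "proj_point J u \<in> embed ` zero_locus I F" by blast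
next
  assume "proj_point J u \<in> embed ` zero_locus I F"
  then obtain x where x: "x \<in> zero_locus I F" "proj_point J u = embed x" by blast
  show "proj_point J u \<in> zariski_proj J closure_of (embed ` S0)"
    unfolding x(2) in_closure_of
  proof (intro conjI allI impI)
    show "embed x \<in> topspace (zariski_proj J)" by (simp add: embed_in_proj_space)
    fix T assume T: "embed x \<in> T \<and> openin (zariski_proj J) T"
    have "openin (zariski_affine I) {x \<in> topspace (zariski_affine I). embed x \<in> T}"
      using openin_continuous_map_preimage[OF continuous_embed] T by blast
    from dense[OF this, of x] T x(1) show "\<exists>y. y \<in> embed ` S0 \<and> y \<in> T"
      by (auto simp: zero_locus_def)
  qed
qed

end


section \<open>Generic translations\<close>

lemma continuous_on_peval: "continuous_on UNIV (\<lambda>x. peval x P)"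
  by (rule closed_under_peval[where C = "continuous_on UNIV" and I = UNIV and \<phi> = "\<lambda>x. x"])
     (auto intro!: continuous_intros continuous_on_product_coordinates simp: polys_def)

text \<open>
  The Euclidean topology is finer, so that Euclidean density gives Zariski density.
\<close>

lemma openin_zariski_affine_imp_open:
  assumes "openin (zariski_affine I) U"
  obtains T where "open T" "U = T \<inter> affine_space I"
proof -
  have "continuous_map (top_of_set (affine_space I)) (zariski_affine I) (\<lambda>x. x)"
    unfolding zariski_affine_def
  proof (rule continuous_on_generated_topo, safe)
    fix P :: "'a rpoly"
    have "open ((\<lambda>x. peval x P) -` (- {0}))"
      by (rule open_vimage[OF _ continuous_on_peval]) auto
    moreover have "(\<lambda>x. x) -` {x \<in> affine_space I. peval x P \<noteq> 0} \<inter> topspace (top_of_set (affine_space I))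
      = (\<lambda>x. peval x P) -` (- {0}) \<inter> affine_space I"
      by auto
    ultimately show "openin (top_of_set (affine_space I))
      ((\<lambda>x. x) -` {x \<in> affine_space I. peval x P \<noteq> 0} \<inter> topspace (top_of_set (affine_space I)))"
      by (auto simp: openin_subtopology)
  next
    fix x assume "x \<in> topspace (top_of_set (affine_space I))"
    then have "x \<in> topspace (zariski_affine I)" by simp
    then show "x \<in> \<Union> {{x \<in> affine_space I. peval x P \<noteq> 0} |P. P \<in> polys I}"
      unfolding zariski_affine_def by simp
  qed
  from openin_continuous_map_preimage[OF this assms]
  have "openin (top_of_set (affine_space I)) U"
    using openin_subset[OF assms] by (simp add: Collect_conj_eq Int_absorb1 Int_absorb2 inf_commute)
  then show ?thesis using that by (auto simp: openin_subtopology)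
qed

definition locally_constant_values :: "('i \<Rightarrow> real) set \<Rightarrow> 'i \<Rightarrow> real set" where
  "locally_constant_values S i = {e. \<exists>T. open T \<and> T \<inter> S \<noteq> {} \<and> (\<forall>x \<in> T \<inter> S. x i = e)}"

text \<open>
  Each such value is the one that the coordinate takes on \<open>S\<close> in some set of a fixed basis,
  and the Euclidean topology has a countable basis. With uncountably many translations to choose
  from, this replaces the decomposition of \<open>S\<close> into irreducible components.
\<close>

lemma countable_locally_constant_values:
  fixes S :: "('i :: countable \<Rightarrow> real) set"
  shows "countable (locally_constant_values S i)"
proof -
  obtain B :: "('i \<Rightarrow> real) set set" where B: "countable B" "topological_basis B"
    using ex_countable_basis by blast
  have "locally_constant_values S i \<subseteq> (\<lambda>b. (SOME x. x \<in> b \<inter> S) i) ` B"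
  proof
    fix e assume "e \<in> locally_constant_values S i"
    then obtain T x where T: "open T" "x \<in> T \<inter> S" "\<forall>x \<in> T \<inter> S. x i = e"
      by (auto simp: locally_constant_values_def)
    from T(2) obtain b where b: "b \<in> B" "x \<in> b" "b \<subseteq> T"
      by (auto elim: topological_basisE[OF B(2) T(1)])
    have "(SOME x. x \<in> b \<inter> S) \<in> b \<inter> S" by (rule someI[of _ x]) (use b T in auto)
    then have "(SOME x. x \<in> b \<inter> S) i = e" using T(3) b(3) by blast
    then show "e \<in> (\<lambda>b. (SOME x. x \<in> b \<inter> S) i) ` B"
      by (rule image_eqI[OF sym b(1)])
  qed
  then show ?thesis by (rule countable_subset) (intro countable_image B(1))
qed

lemma open_avoids_hyperplanes:
  fixes S :: "('i \<Rightarrow> real) set"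
  assumes "finite H" "\<And>i e. (i, e) \<in> H \<Longrightarrow> e \<notin> locally_constant_values S i"
    and "open T" "T \<inter> S \<noteq> {}"
  shows "\<exists>x \<in> T \<inter> S. \<forall>(i, e) \<in> H. x i \<noteq> e"
  using assms
proof (induction H arbitrary: T rule: finite_induct)
  case empty
  then show ?case by auto
next
  case (insert h H)
  obtain i e where h: "h = (i, e)" by (cases h)
  let ?T = "T \<inter> (\<lambda>x. x i) -` (- {e})"
  have "open ((\<lambda>x::'i \<Rightarrow> real. x i) -` (- {e}))"
    by (rule open_vimage) (auto intro: continuous_on_product_coordinates)
  then have "open ?T" using insert.prems(2) by auto
  moreover have "e \<notin> locally_constant_values S i" using insert.prems(1)[of i e] h by simp
  then have "?T \<inter> S \<noteq> {}"
    using insert.prems(2,3) unfolding locally_constant_values_def by blast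
  ultimately have "\<exists>x \<in> ?T \<inter> S. \<forall>(i, e) \<in> H. x i \<noteq> e"
    by (rule insert.IH[rotated]) (use insert.prems(1) in blast)
  then show ?case using h by auto
qed

text \<open>
  The values 0, 1 and -1 of the translated coordinates are those on which some coordinate
  of a profile, or the sum of all of them, will vanish.
\<close>

lemma generic_translation:
  fixes S :: "('i :: countable \<Rightarrow> real) set"
  assumes "finite I"
  obtains c :: "'i \<Rightarrow> real" where
    "\<And>T x. openin (zariski_affine I) T \<Longrightarrow> x \<in> T \<Longrightarrow> x \<in> S \<Longrightarrow> S \<subseteq> affine_space I \<Longrightarrow>
       \<exists>y \<in> T \<inter> S. \<forall>i \<in> I. y i - c i \<notin> {-1, 0, 1}"
proof -
  have "\<exists>a. \<forall>k \<in> {-1, 0, 1}. a + k \<notin> locally_constant_values S i" for i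
  proof -
    let ?E = "\<Union>k \<in> {-1, 0, 1}. (\<lambda>e. e - k) ` locally_constant_values S i"
    have "countable ?E"
      by (intro countable_UN countable_image countable_locally_constant_values) auto
    then obtain a where "a \<notin> ?E"
      using uncountable_UNIV_real by (metis UNIV_I countable_subset subsetI)
    moreover have "a \<in> ?E" if "k \<in> {-1, 0, 1}" "a + k \<in> locally_constant_values S i" for k
      using that(1) image_eqI[of a "\<lambda>e. e - k", OF _ that(2)] by (intro UN_I[of k]) auto
    ultimately show ?thesis by blast
  qed
  then obtain c where c: "\<And>i k. k \<in> {-1, 0, 1} \<Longrightarrow> c i + k \<notin> locally_constant_values S i" by metis
  show ?thesis
  proof (rule that[of c])
    fix U x assume U: "openin (zariski_affine I) U" "x \<in> U" "x \<in> S" "S \<subseteq> affine_space I"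
    obtain T where T: "open T" "U = T \<inter> affine_space I"
      using openin_zariski_affine_imp_open[OF U(1)] .
    let ?H = "(\<lambda>(i, k). (i, c i + k)) ` (I \<times> {-1, 0, 1})"
    have "\<exists>y \<in> T \<inter> S. \<forall>(i, e) \<in> ?H. y i \<noteq> e"
      by (rule open_avoids_hyperplanes) (use assms T U c in auto)
    then obtain y where "y \<in> T \<inter> S" "\<forall>(i, e) \<in> ?H. y i \<noteq> e" ..
    then show "\<exists>y \<in> U \<inter> S. \<forall>i \<in> I. y i - c i \<notin> {-1, 0, 1}"
      using T(2) U(4) by (intro bexI[of _ y]) (force simp: algebra_simps)+
  qed
qed


section \<open>Sums over strategy profiles\<close>

lemma finite_profiles [simp]: "finite (profiles N)"
  by (simp add: profiles_def finite_PiE)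

lemma profiles_dest: "j \<in> profiles N \<Longrightarrow> i \<in> {1..N} \<Longrightarrow> j i = 1 \<or> j i = 2"
  by (auto simp: profiles_def PiE_def Pi_def)

lemma sum_profiles_Suc:
  "(\<Sum>j \<in> profiles (Suc N). F j) = (\<Sum>j \<in> profiles N. F (j(Suc N := 1)) + (F (j(Suc N := 2)) :: real))"
proof -
  have eq: "profiles (Suc N) = (\<lambda>(a, j). j(Suc N := a)) ` ({1, 2} \<times> profiles N)"
    unfolding profiles_def by (subst PiE_insert_eq[symmetric]) (simp add: atLeastAtMostSuc_conv)
  have inj: "inj_on (\<lambda>(a, j). j(Suc N := a)) ({1, 2} \<times> profiles N)"
    using inj_combinator[of "Suc N" "{1..N}" "\<lambda>_. {1, 2 :: nat}"] by (simp add: profiles_def)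
  have "(\<Sum>j \<in> profiles (Suc N). F j) = (\<Sum>(a, j) \<in> {1, 2} \<times> profiles N. F (j(Suc N := a)))"
    unfolding eq by (subst sum.reindex[OF inj]) (simp add: o_def case_prod_beta)
  also have "\<dots> = (\<Sum>j \<in> profiles N. F (j(Suc N := 1)) + F (j(Suc N := 2)))"
    by (simp add: sum.cartesian_product[symmetric] sum.distrib)
  finally show ?thesis .
qed

text \<open>
  A rank-one tensor is summed factor by factor. All sums in the Spohn matrices reduce to
  this one, since restricting a sum to the profiles with a given choice, and weighting it by
  a payoff tensor of rank one, again leaves a tensor of rank one.
\<close>

lemma sum_segre:
  "(\<Sum>j \<in> profiles (M + 2 * l). segre (M + 2 * l) l s t j) =
   (\<Prod>i \<in> {1..M}. s i 1 + s i 2) *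
   (\<Prod>r \<in> {1..l}. t r 1 1 + t r 1 2 + t r 2 1 + t r 2 2)"
proof (induction l)
  case 0
  have "(\<Sum>j \<in> profiles M. \<Prod>i \<in> {1..M}. s i (j i)) = (\<Prod>i \<in> {1..M}. s i 1 + s i 2)"
    unfolding profiles_def by (subst prod_sum_PiE[symmetric]) (auto intro!: prod.cong)
  then show ?case by (simp add: segre_def)
next
  case (Suc l)
  let ?K = "M + 2 * l"
  have K: "M + 2 * Suc l = Suc (Suc ?K)" by simp
  have upd: "segre (M + 2 * Suc l) (Suc l) s t (j(Suc ?K := a, Suc (Suc ?K) := b)) =
    segre ?K l s t j * t (Suc l) a b" for j a b
  proof -
    have "(\<Prod>i = 1..M. s i ((j(Suc ?K := a, Suc (Suc ?K) := b)) i)) = (\<Prod>i = 1..M. s i (j i))"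
      by (rule prod.cong) auto
    moreover have "(\<Prod>r = 1..l. t r ((j(Suc ?K := a, Suc (Suc ?K) := b)) (M + 2 * r - 1))
        ((j(Suc ?K := a, Suc (Suc ?K) := b)) (M + 2 * r))) =
      (\<Prod>r = 1..l. t r (j (M + 2 * r - 1)) (j (M + 2 * r)))"
      by (rule prod.cong) auto
    ultimately show ?thesis by (simp add: segre_def)
  qed
  have "(\<Sum>j \<in> profiles (M + 2 * Suc l). segre (M + 2 * Suc l) (Suc l) s t j) =
    (\<Sum>j \<in> profiles ?K. segre ?K l s t j * (t (Suc l) 1 1 + t (Suc l) 1 2 + t (Suc l) 2 1 + t (Suc l) 2 2))"
    unfolding K sum_profiles_Suc upd[unfolded K] by (simp add: algebra_simps)
  also have "\<dots> = (\<Sum>j \<in> profiles ?K. segre ?K l s t j) * (t (Suc l) 1 1 + t (Suc l) 1 2 + t (Suc l) 2 1 + t (Suc l) 2 2)"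
    by (simp add: sum_distrib_right)
  finally show ?case by (simp add: Suc.IH)
qed

lemma segre_mult:
  "segre N l s t j * segre N l s' t' j =
   segre N l (\<lambda>i a. s i a * s' i a) (\<lambda>r a b. t r a b * t' r a b) j"
  by (simp add: segre_def prod.distrib mult_ac)

lemma segre_cong:
  assumes "\<And>i a. i \<in> {1..M} \<Longrightarrow> a \<in> {1, 2} \<Longrightarrow> s i a = s' i a"
    and "\<And>r a b. r \<in> {1..l} \<Longrightarrow> a \<in> {1, 2} \<Longrightarrow> b \<in> {1, 2} \<Longrightarrow> t r a b = t' r a b"
    and "j \<in> profiles (M + 2 * l)"
  shows "segre (M + 2 * l) l s t j = segre (M + 2 * l) l s' t' j"
proof -
  have j: "j i \<in> {1, 2}" if "i \<in> {1..M + 2 * l}" for i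
    using profiles_dest[OF assms(3) that] by blast
  have "(\<Prod>i \<in> {1..M}. s i (j i)) = (\<Prod>i \<in> {1..M}. s' i (j i))"
    by (intro prod.cong refl assms(1) j) auto
  moreover have "(\<Prod>r \<in> {1..l}. t r (j (M + 2 * r - 1)) (j (M + 2 * r))) =
      (\<Prod>r \<in> {1..l}. t' r (j (M + 2 * r - 1)) (j (M + 2 * r)))"
    by (intro prod.cong refl assms(2) j) auto
  ultimately show ?thesis by (simp add: segre_def)
qed

lemma segre_normalise:
  assumes "\<And>i. i \<in> {1..N - 2 * l} \<Longrightarrow> s i 2 \<noteq> 0" "\<And>r. r \<in> {1..l} \<Longrightarrow> t r 2 2 \<noteq> 0"
  shows "proj_point J (segre N l s t) =
    proj_point J (segre N l (\<lambda>i a. s i a / s i 2) (\<lambda>r a b. t r a b / t r 2 2))"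
proof (rule proj_point_eqI)
  let ?k = "(\<Prod>i \<in> {1..N - 2 * l}. s i 2) * (\<Prod>r \<in> {1..l}. t r 2 2)"
  show "?k \<noteq> 0" using assms by auto
  then show "segre N l s t j = ?k * segre N l (\<lambda>i a. s i a / s i 2) (\<lambda>r a b. t r a b / t r 2 2) j" for j
    by (simp add: segre_def prod_dividef)
qed


section \<open>Determinants of Spohn matrices\<close>

lemma det_spohn_scale:
  assumes "\<And>j. j \<in> profiles N \<Longrightarrow> p j = k * u j"
  shows "det (spohn_matrix N X i p) = k\<^sup>2 * det (spohn_matrix N X i u)"
proof -
  have "(\<Sum>j \<in> {j \<in> profiles N. j i = a}. p j) = k * (\<Sum>j \<in> {j \<in> profiles N. j i = a}. u j)" for a
    unfolding sum_distrib_left by (rule sum.cong) (auto simp: assms)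
  moreover have "(\<Sum>j \<in> {j \<in> profiles N. j i = a}. X i j * p j) =
      k * (\<Sum>j \<in> {j \<in> profiles N. j i = a}. X i j * u j)" for a
    unfolding sum_distrib_left by (rule sum.cong) (auto simp: assms)
  ultimately show ?thesis
    by (simp add: spohn_matrix_def Let_def det_2 power2_eq_square algebra_simps)
qed

text \<open>
  A player who is paid nothing for the first choice has a Spohn matrix with a zero entry, so
  that the determinant factors.
\<close>

lemma det_spohn_factored:
  assumes i: "i \<in> {1..N}" and X: "\<And>j. j \<in> profiles N \<Longrightarrow> j i = 1 \<Longrightarrow> X i j = 0"
  shows "det (spohn_matrix N X i p) =
    (\<Sum>j \<in> profiles N. of_bool (j i = 1) * p j) * (\<Sum>j \<in> profiles N. X i j * p j)"
proof -
  have "(\<Sum>j \<in> {j \<in> profiles N. j i = 1}. X i j * p j) = 0"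
    by (rule sum.neutral) (auto simp: X)
  moreover have "(\<Sum>j \<in> {j \<in> profiles N. j i = 2}. X i j * p j) = (\<Sum>j \<in> profiles N. X i j * p j)"
    by (rule sum.mono_neutral_left) (use i X profiles_dest in auto)
  moreover have "(\<Sum>j \<in> {j \<in> profiles N. j i = 1}. p j) = (\<Sum>j \<in> profiles N. of_bool (j i = 1) * p j)"
    by (rule sum.mono_neutral_cong_left) auto
  ultimately show ?thesis
    by (simp add: spohn_matrix_def Let_def det_2)
qed

lemma proj_point_in_spohn_variety:
  assumes "j \<in> profiles N" "v j \<noteq> 0"
  shows "proj_point (profiles N) v \<in> spohn_variety N X \<longleftrightarrow>
    (\<forall>i \<in> {1..N}. det (spohn_matrix N X i v) = 0)"
proof
  assume *: "proj_point (profiles N) v \<in> spohn_variety N X"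
  show "\<forall>i \<in> {1..N}. det (spohn_matrix N X i v) = 0"
  proof
    fix i assume "i \<in> {1..N}"
    then have "det (spohn_matrix N X i (restrict v (profiles N))) = 0"
      using * proj_point_self unfolding spohn_variety_def by blast
    then show "det (spohn_matrix N X i v) = 0"
      using det_spohn_scale[of N "restrict v (profiles N)" 1 v X i] by simp
  qed
next
  assume *: "\<forall>i \<in> {1..N}. det (spohn_matrix N X i v) = 0"
  have "det (spohn_matrix N X i p) = 0" if i: "i \<in> {1..N}" and p: "p \<in> proj_point (profiles N) v" for i p
  proof -
    obtain k where "k \<noteq> 0" "\<And>j. j \<in> profiles N \<Longrightarrow> p j = k * v j"
      using p by (rule proj_pointE) blast
    then show ?thesis using det_spohn_scale[of N p k v X i] * i by simp
  qed
  then show "proj_point (profiles N) v \<in> spohn_variety N X"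
    unfolding spohn_variety_def using proj_point_in_proj_space[where v = v, OF assms] by blast
qed


section \<open>Points off the excluded hyperplanes\<close>

definition off_hyperplanes ::
  "nat \<Rightarrow> nat \<Rightarrow> (nat \<Rightarrow> nat \<Rightarrow> real) \<Rightarrow> (nat \<Rightarrow> nat \<Rightarrow> nat \<Rightarrow> real) \<Rightarrow> bool" where
  "off_hyperplanes M l s t \<longleftrightarrow>
     (\<forall>i \<in> {1..M}. s i 1 \<noteq> 0 \<and> s i 2 \<noteq> 0 \<and> s i 1 + s i 2 \<noteq> 0) \<and>
     (\<forall>r \<in> {1..l}. t r 1 1 \<noteq> 0 \<and> t r 1 2 \<noteq> 0 \<and> t r 2 1 \<noteq> 0 \<and> t r 2 2 \<noteq> 0 \<and>
        t r 1 1 + t r 1 2 + t r 2 1 + t r 2 2 \<noteq> 0)"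

text \<open>
  Since every choice of one entry per factor occurs as a profile, and the total is the product of
  the totals of the factors, the excluded hyperplanes can be described factor by factor.
\<close>

lemma off_hyperplanes_iff:
  "off_hyperplanes M l s t \<longleftrightarrow>
     (\<forall>j \<in> profiles (M + 2 * l). segre (M + 2 * l) l s t j \<noteq> 0) \<and>
     (\<Sum>j \<in> profiles (M + 2 * l). segre (M + 2 * l) l s t j) \<noteq> 0"
proof (intro iffI conjI ballI)
  assume off: "off_hyperplanes M l s t"
  then show "(\<Sum>j \<in> profiles (M + 2 * l). segre (M + 2 * l) l s t j) \<noteq> 0"
    unfolding sum_segre by (auto simp: off_hyperplanes_def)
  fix j assume j: "j \<in> profiles (M + 2 * l)"
  have "s i (j i) \<noteq> 0" if "i \<in> {1..M}" for i
    using profiles_dest[OF j, of i] off that by (auto simp: off_hyperplanes_def)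
  moreover have "t r (j (M + 2 * r - 1)) (j (M + 2 * r)) \<noteq> 0" if "r \<in> {1..l}" for r
  proof -
    have "M + 2 * r - 1 \<in> {1..M + 2 * l}" "M + 2 * r \<in> {1..M + 2 * l}" using that by auto
    from this[THEN profiles_dest[OF j]] show ?thesis
      using off that unfolding off_hyperplanes_def by metis
  qed
  ultimately show "segre (M + 2 * l) l s t j \<noteq> 0"
    by (auto simp: segre_def)
next
  assume *: "(\<forall>j \<in> profiles (M + 2 * l). segre (M + 2 * l) l s t j \<noteq> 0) \<and>
     (\<Sum>j \<in> profiles (M + 2 * l). segre (M + 2 * l) l s t j) \<noteq> 0"
  have "s i a \<noteq> 0" if "i \<in> {1..M}" "a \<in> {1, 2}" for i a
  proof -
    let ?j = "\<lambda>k \<in> {1..M + 2 * l}. if k = i then a else 1"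
    have "?j \<in> profiles (M + 2 * l)" using that by (auto simp: profiles_def)
    with * have "segre (M + 2 * l) l s t ?j \<noteq> 0" by blast
    then have "(\<Prod>i \<in> {1..M}. s i (?j i)) \<noteq> 0"
      by (simp only: segre_def add_diff_cancel_right' mult_eq_0_iff) blast
    then have "s i (?j i) \<noteq> 0" using that by (simp del: restrict_apply)
    then show ?thesis using that by simp
  qed
  moreover have "t r a b \<noteq> 0" if "r \<in> {1..l}" "a \<in> {1, 2}" "b \<in> {1, 2}" for r a b
  proof -
    let ?j = "\<lambda>k \<in> {1..M + 2 * l}. if k = M + 2 * r - 1 then a else if k = M + 2 * r then b else 1"
    have "?j \<in> profiles (M + 2 * l)" using that by (auto simp: profiles_def)
    with * have "segre (M + 2 * l) l s t ?j \<noteq> 0" by blast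
    then have "(\<Prod>r \<in> {1..l}. t r (?j (M + 2 * r - 1)) (?j (M + 2 * r))) \<noteq> 0"
      by (simp only: segre_def add_diff_cancel_right' mult_eq_0_iff) blast
    then have "t r (?j (M + 2 * r - 1)) (?j (M + 2 * r)) \<noteq> 0" using that by (simp del: restrict_apply)
    moreover have "?j (M + 2 * r - 1) = a" "?j (M + 2 * r) = b" using that by auto
    ultimately show ?thesis by simp
  qed
  ultimately show "off_hyperplanes M l s t"
    using * unfolding sum_segre off_hyperplanes_def by auto
qed

lemma proj_point_off_hyperplanes:
  assumes "proj_point (profiles (M + 2 * l)) (segre (M + 2 * l) l s t) \<in> proj_space (profiles (M + 2 * l))"
  shows "proj_point (profiles (M + 2 * l)) (segre (M + 2 * l) l s t) \<notin> excluded_hyperplanes (M + 2 * l) \<longleftrightarrow>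
    off_hyperplanes M l s t"
proof -
  let ?J = "profiles (M + 2 * l)" and ?v = "segre (M + 2 * l) l s t"
  have "(\<exists>p \<in> proj_point ?J ?v. (\<forall>j \<in> ?J. p j \<noteq> 0) \<and> (\<Sum>j \<in> ?J. p j) \<noteq> 0) \<longleftrightarrow>
    (\<forall>j \<in> ?J. ?v j \<noteq> 0) \<and> (\<Sum>j \<in> ?J. ?v j) \<noteq> 0" (is "?L \<longleftrightarrow> ?R")
  proof
    assume ?L
    then obtain p where p: "\<forall>j \<in> ?J. p j \<noteq> 0" "(\<Sum>j \<in> ?J. p j) \<noteq> 0"
      and "p \<in> proj_point ?J ?v"
      by blast
    from this(3) obtain k where "k \<noteq> 0" and k: "\<And>j. j \<in> ?J \<Longrightarrow> p j = k * ?v j"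
      by (rule proj_pointE) blast
    have "(\<Sum>j \<in> ?J. p j) = k * (\<Sum>j \<in> ?J. ?v j)"
      unfolding sum_distrib_left by (rule sum.cong) (auto simp: k)
    then show ?R using p k by auto
  next
    assume ?R
    then show ?L by (intro bexI[OF _ proj_point_self]) auto
  qed
  then show ?thesis
    using assms by (auto simp: excluded_hyperplanes_def off_hyperplanes_iff)
qed

text \<open>
  A weight that depends on one factor only changes that factor alone, and off the
  excluded hyperplanes the totals of the other factors can be cancelled.
\<close>

lemma sum_weighted_single:
  assumes q: "q \<in> {1..M}" and off: "off_hyperplanes M l s t"
  shows "(\<Sum>j \<in> profiles (M + 2 * l). f (j q) * segre (M + 2 * l) l s t j) = 0 \<longleftrightarrow>
    f 1 * s q 1 + f 2 * s q 2 = 0"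
proof -
  let ?f = "\<lambda>i a. if i = q then f a else 1"
  have "f (j q) = segre (M + 2 * l) l ?f (\<lambda>_ _ _. 1) j" for j
    using q by (simp add: segre_def prod.delta)
  then have "(\<Sum>j \<in> profiles (M + 2 * l). f (j q) * segre (M + 2 * l) l s t j) =
    (\<Prod>i \<in> {1..M}. ?f i 1 * s i 1 + ?f i 2 * s i 2) *
    (\<Prod>r \<in> {1..l}. t r 1 1 + t r 1 2 + t r 2 1 + t r 2 2)" (is "?S = _")
    by (simp only: segre_mult sum_segre) simp
  then have "?S = 0 \<longleftrightarrow> (\<exists>i \<in> {1..M}. ?f i 1 * s i 1 + ?f i 2 * s i 2 = 0)"
    using off by (auto simp: off_hyperplanes_def)
  also have "\<dots> \<longleftrightarrow> f 1 * s q 1 + f 2 * s q 2 = 0"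
    using q off by (auto simp: off_hyperplanes_def split: if_splits)
  finally show ?thesis .
qed

lemma sum_weighted_pair:
  assumes r: "r \<in> {1..l}" and off: "off_hyperplanes M l s t"
  shows "(\<Sum>j \<in> profiles (M + 2 * l). h (j (M + 2 * r - 1)) (j (M + 2 * r)) * segre (M + 2 * l) l s t j) = 0 \<longleftrightarrow>
    h 1 1 * t r 1 1 + h 1 2 * t r 1 2 + h 2 1 * t r 2 1 + h 2 2 * t r 2 2 = 0"
proof -
  let ?h = "\<lambda>r' a b. if r' = r then h a b else 1"
  have "h (j (M + 2 * r - 1)) (j (M + 2 * r)) = segre (M + 2 * l) l (\<lambda>_ _. 1) ?h j" for j
    using r by (simp add: segre_def prod.delta)
  then have "(\<Sum>j \<in> profiles (M + 2 * l). h (j (M + 2 * r - 1)) (j (M + 2 * r)) * segre (M + 2 * l) l s t j) =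
    (\<Prod>i \<in> {1..M}. s i 1 + s i 2) *
    (\<Prod>r' \<in> {1..l}. ?h r' 1 1 * t r' 1 1 + ?h r' 1 2 * t r' 1 2 + ?h r' 2 1 * t r' 2 1 + ?h r' 2 2 * t r' 2 2)" (is "?S = _")
    by (simp only: segre_mult sum_segre) simp
  then have "?S = 0 \<longleftrightarrow> (\<exists>r' \<in> {1..l}. ?h r' 1 1 * t r' 1 1 + ?h r' 1 2 * t r' 1 2 + ?h r' 2 1 * t r' 2 1 + ?h r' 2 2 * t r' 2 2 = 0)"
    using off by (auto simp: off_hyperplanes_def)
  also have "\<dots> \<longleftrightarrow> h 1 1 * t r 1 1 + h 1 2 * t r 1 2 + h 2 1 * t r 2 1 + h 2 2 * t r 2 2 = 0"
    using r off by (auto simp: off_hyperplanes_def split: if_splits)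
  finally show ?thesis .
qed


section \<open>Slots\<close>

text \<open>
  The slots \<open>(i, k)\<close> with \<open>0 \<le> k \<le> d i\<close> stand for the copies of the \<open>i\<close>-th affine coordinate.
  Each slot belongs to one singleton player, except that the slots \<open>(i, 0)\<close> of the last \<open>l\<close>
  coordinates belong to the \<open>l\<close> pairs.
\<close>

locale slot_assignment =
  fixes n l M :: nat and d :: "nat \<Rightarrow> nat" and b :: "nat \<Rightarrow> nat \<times> nat"
  assumes l_le: "l \<le> n"
    and b: "bij_betw b {1..M} {(i, k). i \<in> {1..n} \<and> k \<le> d i \<and> (k = 0 \<longrightarrow> i \<le> n - l)}"
begin

abbreviation N :: nat where "N \<equiv> M + 2 * l"

definition slots :: "(nat \<times> nat) set" where "slots = (SIGMA i:{1..n}. {..d i})"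

definition singles :: "(nat \<times> nat) set" where
  "singles = {(i, k). i \<in> {1..n} \<and> k \<le> d i \<and> (k = 0 \<longrightarrow> i \<le> n - l)}"

definition pair_slot :: "nat \<Rightarrow> nat \<times> nat" where "pair_slot r = (n - l + r, 0)"

lemma finite_slots [simp]: "finite slots"
  by (simp add: slots_def)

lemma b_image: "b ` {1..M} = singles" and b_inj: "inj_on b {1..M}"
  using b by (simp_all add: bij_betw_def singles_def)

lemma b_single: "q \<in> {1..M} \<Longrightarrow> b q \<in> singles"
  unfolding b_image[symmetric] by (rule imageI)

lemma pair_slot_not_single: "r \<in> {1..l} \<Longrightarrow> pair_slot r \<notin> singles"
  by (simp add: pair_slot_def singles_def)

lemma slots_eq: "slots = b ` {1..M} \<union> pair_slot ` {1..l}"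
proof -
  have "(i, 0) \<in> pair_slot ` {1..l}" if "i \<in> {1..n}" "\<not> i \<le> n - l" for i
    using that l_le by (intro image_eqI[of _ _ "i - (n - l)"]) (auto simp: pair_slot_def)
  then have "u \<in> singles \<union> pair_slot ` {1..l}" if "u \<in> slots" for u
    using that by (cases u) (auto simp: slots_def singles_def)
  moreover have "singles \<union> pair_slot ` {1..l} \<subseteq> slots"
    using l_le by (auto simp: slots_def singles_def pair_slot_def)
  ultimately have "slots = singles \<union> pair_slot ` {1..l}" by blast
  then show ?thesis unfolding b_image .
qed

lemma prod_slots: "(\<Prod>u \<in> slots. F u) = (\<Prod>q \<in> {1..M}. F (b q)) * (\<Prod>r \<in> {1..l}. (F (pair_slot r) :: real))"
proof -
  have inj: "inj_on pair_slot {1..l}" by (auto simp: inj_on_def pair_slot_def)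
  have "b ` {1..M} \<inter> pair_slot ` {1..l} = {}"
    unfolding b_image using pair_slot_not_single by auto
  then have "(\<Prod>u \<in> slots. F u) = (\<Prod>u \<in> b ` {1..M}. F u) * (\<Prod>u \<in> pair_slot ` {1..l}. F u)"
    unfolding slots_eq by (intro prod.union_disjoint) auto
  then show ?thesis
    by (simp only: prod.reindex[OF b_inj] prod.reindex[OF inj] o_def)
qed

text \<open>
  The coordinate that a point of the chart has in a slot: the free coordinate of a singleton's
  projective line, or the corner \<open>(1, 1)\<close> of a pair's projective 3-space.
\<close>

definition slot_coord :: "(nat \<Rightarrow> nat \<Rightarrow> real) \<Rightarrow> (nat \<Rightarrow> nat \<Rightarrow> nat \<Rightarrow> real) \<Rightarrow> nat \<times> nat \<Rightarrow> real" where
  "slot_coord s t u =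
     (if u \<in> singles then s (inv_into {1..M} b u) 1 else t (fst u - (n - l)) 1 1)"

lemma slot_coord_single [simp]: "q \<in> {1..M} \<Longrightarrow> slot_coord s t (b q) = s q 1"
  using b_single[of q] inv_into_f_f[OF b_inj, of q] by (simp add: slot_coord_def)

lemma slot_coord_pair [simp]: "r \<in> {1..l} \<Longrightarrow> slot_coord s t (pair_slot r) = t r 1 1"
  using pair_slot_not_single[of r] by (simp add: slot_coord_def) (simp add: pair_slot_def)

definition normalised :: "(nat \<Rightarrow> nat \<Rightarrow> real) \<Rightarrow> (nat \<Rightarrow> nat \<Rightarrow> nat \<Rightarrow> real) \<Rightarrow> bool" where
  "normalised s t \<longleftrightarrow> (\<forall>q \<in> {1..M}. s q 2 = 1) \<and> (\<forall>r \<in> {1..l}. t r 2 2 = 1)"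


subsection \<open>Multiaffine payoffs of singleton players\<close>

text \<open>
  The functions of the slot coordinates that can be prescribed as the second factor of the
  determinant of the singleton player \<open>q\<close>.
\<close>

definition payoff_form :: "nat \<Rightarrow> ((nat \<times> nat \<Rightarrow> real) \<Rightarrow> real) \<Rightarrow> bool" where
  "payoff_form q L \<longleftrightarrow> (\<exists>D. (\<forall>j \<in> profiles N. j q = 1 \<longrightarrow> D j = 0) \<and>
     (\<forall>s t. normalised s t \<longrightarrow> (\<Sum>j \<in> profiles N. D j * segre N l s t j) = L (slot_coord s t)))"

lemma payoff_form_zero: "payoff_form q (\<lambda>w. 0)"
  unfolding payoff_form_def by (rule exI[of _ "\<lambda>_. 0"]) simp

lemma payoff_form_add:
  assumes "payoff_form q L" "payoff_form q L'" shows "payoff_form q (\<lambda>w. L w + L' w)"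
proof -
  from assms obtain D D' where
    "\<forall>j \<in> profiles N. j q = 1 \<longrightarrow> D j = 0" "\<forall>j \<in> profiles N. j q = 1 \<longrightarrow> D' j = 0"
    "\<forall>s t. normalised s t \<longrightarrow> (\<Sum>j \<in> profiles N. D j * segre N l s t j) = L (slot_coord s t)"
    "\<forall>s t. normalised s t \<longrightarrow> (\<Sum>j \<in> profiles N. D' j * segre N l s t j) = L' (slot_coord s t)"
    unfolding payoff_form_def by blast
  then show ?thesis
    unfolding payoff_form_def
    by (intro exI[of _ "\<lambda>j. D j + D' j"]) (auto simp: distrib_right sum.distrib)
qed

lemma payoff_form_scale:
  assumes "payoff_form q L" shows "payoff_form q (\<lambda>w. a * L w)"
proof -
  from assms obtain D where
    "\<forall>j \<in> profiles N. j q = 1 \<longrightarrow> D j = 0"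
    "\<forall>s t. normalised s t \<longrightarrow> (\<Sum>j \<in> profiles N. D j * segre N l s t j) = L (slot_coord s t)"
    unfolding payoff_form_def by blast
  then show ?thesis
    unfolding payoff_form_def
    by (intro exI[of _ "\<lambda>j. a * D j"]) (auto simp: mult.assoc simp flip: sum_distrib_left)
qed

lemma payoff_form_sum:
  "(\<And>k. k \<in> K \<Longrightarrow> payoff_form q (L k)) \<Longrightarrow> payoff_form q (\<lambda>w. \<Sum>k \<in> K. L k w)"
  by (induction K rule: infinite_finite_induct) (auto intro: payoff_form_zero payoff_form_add)

text \<open>
  A product of affine functions of distinct slot coordinates comes from a payoff tensor of
  rank one. A factor 1 at the slot of \<open>q\<close> itself becomes the tensor factor \<open>(0, 1)\<close>, and
  it is this factor that makes the payoff vanish on the first choice of \<open>q\<close>.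
\<close>

lemma payoff_form_prod:
  assumes q: "q \<in> {1..M}" and A: "A \<subseteq> slots" "b q \<notin> A"
  shows "payoff_form q (\<lambda>w. \<Prod>u \<in> A. w u + c u)"
  unfolding payoff_form_def
proof (intro exI conjI allI impI ballI)
  let ?\<alpha> = "\<lambda>u. of_bool (u \<in> A) :: real" and ?\<beta> = "\<lambda>u. if u \<in> A then c u else 1"
  let ?s = "\<lambda>i a. if a = 1 then ?\<alpha> (b i) else ?\<beta> (b i)"
  let ?t = "\<lambda>r a a'. if a = 1 \<and> a' = 1 then ?\<alpha> (pair_slot r)
     else if a = 2 \<and> a' = (2::nat) then ?\<beta> (pair_slot r) else 0"
  let ?D = "segre N l ?s ?t"
  {
    fix j :: "nat \<Rightarrow> nat" assume "j q = 1"
    then have "(\<Prod>i \<in> {1..M}. ?s i (j i)) = 0"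
      using q A(2) by (intro prod_zero bexI[of _ q]) auto
    then show "?D j = 0" by (simp add: segre_def)
  next
    fix s t assume "normalised s t"
    then have st: "\<And>q. q \<in> {1..M} \<Longrightarrow> s q 2 = 1" "\<And>r. r \<in> {1..l} \<Longrightarrow> t r 2 2 = 1"
      by (auto simp: normalised_def)
    have "(\<Sum>j \<in> profiles N. ?D j * segre N l s t j) =
      (\<Prod>i \<in> {1..M}. ?\<alpha> (b i) * s i 1 + ?\<beta> (b i)) *
      (\<Prod>r \<in> {1..l}. ?\<alpha> (pair_slot r) * t r 1 1 + ?\<beta> (pair_slot r))"
      unfolding segre_mult sum_segre
      by (intro arg_cong2[where f = "(*)"] prod.cong refl) (simp_all add: st)
    also have "\<dots> = (\<Prod>u \<in> slots. ?\<alpha> u * slot_coord s t u + ?\<beta> u)"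
      unfolding prod_slots by (intro arg_cong2[where f = "(*)"] prod.cong refl) simp_all
    also have "\<dots> = (\<Prod>u \<in> A. slot_coord s t u + c u)"
      by (rule prod.mono_neutral_cong_right) (use A(1) in auto)
    finally show "(\<Sum>j \<in> profiles N. ?D j * segre N l s t j) = (\<Prod>u \<in> A. slot_coord s t u + c u)" .
  }
qed

lemma payoff_form_const: "q \<in> {1..M} \<Longrightarrow> payoff_form q (\<lambda>w. a)"
  using payoff_form_scale[OF payoff_form_prod[of q "{}"], of a] by simp

lemma payoff_form_coord: "q \<in> {1..M} \<Longrightarrow> u \<in> slots \<Longrightarrow> u \<noteq> b q \<Longrightarrow> payoff_form q (\<lambda>w. w u)"
  using payoff_form_prod[of q "{u}" "\<lambda>_. 0"] by simp

lemma payoff_form_diff: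
  "payoff_form q L \<Longrightarrow> payoff_form q L' \<Longrightarrow> payoff_form q (\<lambda>w. L w - L' w)"
  using payoff_form_add[of q L "\<lambda>w. (-1) * L' w"] payoff_form_scale[of q L' "-1"] by simp


subsection \<open>The game of a system of payoff forms\<close>

text \<open>
  The two members of a pair are paid 1 if both make the second choice. Off the
  excluded hyperplanes the second factor of their determinants is then nonzero, and the first
  factors put the point of the pair on the line \<open>(w, -w, -w, 1)\<close>.
\<close>

lemma exists_game:
  assumes E: "\<And>q. q \<in> {1..M} \<Longrightarrow> payoff_form q (E q)"
  obtains X :: game where
    "\<And>s t. normalised s t \<Longrightarrow> off_hyperplanes M l s t \<Longrightarrow>
      (\<forall>i \<in> {1..N}. det (spohn_matrix N X i (segre N l s t)) = 0) \<longleftrightarrow>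
      (\<forall>q \<in> {1..M}. E q (slot_coord s t) = 0) \<and>
      (\<forall>r \<in> {1..l}. t r 1 1 + t r 1 2 = 0 \<and> t r 1 1 + t r 2 1 = 0)"
proof -
  have "\<forall>q \<in> {1..M}. \<exists>D. (\<forall>j \<in> profiles N. j q = 1 \<longrightarrow> D j = 0) \<and>
     (\<forall>s t. normalised s t \<longrightarrow> (\<Sum>j \<in> profiles N. D j * segre N l s t j) = E q (slot_coord s t))"
    using E unfolding payoff_form_def by simp
  from bchoice[OF this] obtain D where
    "\<forall>q \<in> {1..M}. (\<forall>j \<in> profiles N. j q = 1 \<longrightarrow> D q j = 0) \<and>
     (\<forall>s t. normalised s t \<longrightarrow> (\<Sum>j \<in> profiles N. D q j * segre N l s t j) = E q (slot_coord s t))" ..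
  then have D: "\<And>q j. q \<in> {1..M} \<Longrightarrow> j \<in> profiles N \<Longrightarrow> j q = 1 \<Longrightarrow> D q j = 0"
    "\<And>q s t. q \<in> {1..M} \<Longrightarrow> normalised s t \<Longrightarrow>
      (\<Sum>j \<in> profiles N. D q j * segre N l s t j) = E q (slot_coord s t)"
    by simp_all
  \<comment> \<open>Player \<open>i > M\<close> belongs to the pair with number \<open>(i + 1 - M) div 2\<close>.\<close>
  define X :: game where "X = (\<lambda>i j. if i \<le> M then D i j else
     of_bool (j (M + 2 * ((i + 1 - M) div 2) - 1) = 2 \<and> j (M + 2 * ((i + 1 - M) div 2)) = 2))"
  have X_pair: "X i j = of_bool (j (M + 2 * r - 1) = 2 \<and> j (M + 2 * r) = 2)"
    if "r \<in> {1..l}" "i \<in> {M + 2 * r - 1, M + 2 * r}" for i r j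
  proof -
    have "\<not> i \<le> M" "(i + 1 - M) div 2 = r" using that by auto
    then show ?thesis by (simp add: X_def)
  qed
  show ?thesis
  proof (rule that[of X])
    fix s t assume st: "normalised s t" and off: "off_hyperplanes M l s t"
    let ?p = "segre N l s t"
    have single: "det (spohn_matrix N X q ?p) = 0 \<longleftrightarrow> E q (slot_coord s t) = 0"
      if q: "q \<in> {1..M}" for q
    proof -
      have "det (spohn_matrix N X q ?p) =
          (\<Sum>j \<in> profiles N. of_bool (j q = 1) * ?p j) * E q (slot_coord s t)"
        using q D(1)[OF q] D(2)[OF q st] by (subst det_spohn_factored) (auto simp: X_def)
      moreover have "(\<Sum>j \<in> profiles N. of_bool (j q = 1) * ?p j) \<noteq> 0"
        using off q by (subst sum_weighted_single[OF q off]) (simp add: off_hyperplanes_def)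
      ultimately show ?thesis by simp
    qed
    have both_second: "(\<Sum>j \<in> profiles N. of_bool (j (M + 2 * r - 1) = 2 \<and> j (M + 2 * r) = 2) * ?p j) \<noteq> 0"
      if r: "r \<in> {1..l}" for r
      using off r
      by (subst sum_weighted_pair[OF r off, of "\<lambda>a a'. of_bool (a = 2 \<and> a' = 2)"])
         (simp add: off_hyperplanes_def)
    have pair1: "det (spohn_matrix N X (M + 2 * r - 1) ?p) = 0 \<longleftrightarrow> t r 1 1 + t r 1 2 = 0"
      if r: "r \<in> {1..l}" for r
    proof -
      have "det (spohn_matrix N X (M + 2 * r - 1) ?p) =
          (\<Sum>j \<in> profiles N. of_bool (j (M + 2 * r - 1) = 1) * ?p j) *
          (\<Sum>j \<in> profiles N. X (M + 2 * r - 1) j * ?p j)"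
        using r by (intro det_spohn_factored) (auto simp: X_pair[OF r])
      then show ?thesis
        using both_second[OF r] sum_weighted_pair[OF r off, of "\<lambda>a a'. of_bool (a = 1)"]
        by (simp add: X_pair[OF r])
    qed
    have pair2: "det (spohn_matrix N X (M + 2 * r) ?p) = 0 \<longleftrightarrow> t r 1 1 + t r 2 1 = 0"
      if r: "r \<in> {1..l}" for r
    proof -
      have "det (spohn_matrix N X (M + 2 * r) ?p) =
          (\<Sum>j \<in> profiles N. of_bool (j (M + 2 * r) = 1) * ?p j) *
          (\<Sum>j \<in> profiles N. X (M + 2 * r) j * ?p j)"
        using r by (intro det_spohn_factored) (auto simp: X_pair[OF r])
      then show ?thesis
        using both_second[OF r] sum_weighted_pair[OF r off, of "\<lambda>a a'. of_bool (a' = 1)"]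
        by (simp add: X_pair[OF r])
    qed
    have "{1..N} = {1..M} \<union> (\<Union>r \<in> {1..l}. {M + 2 * r - 1, M + 2 * r})"
    proof -
      have "\<exists>r \<in> {1..l}. i = M + 2 * r - 1 \<or> i = M + 2 * r" if "i \<in> {1..N}" "\<not> i \<le> M" for i
        using that by (intro bexI[of _ "(i + 1 - M) div 2"]) auto
      then show ?thesis by fastforce
    qed
    then show "(\<forall>i \<in> {1..N}. det (spohn_matrix N X i ?p) = 0) \<longleftrightarrow>
      (\<forall>q \<in> {1..M}. E q (slot_coord s t) = 0) \<and>
      (\<forall>r \<in> {1..l}. t r 1 1 + t r 1 2 = 0 \<and> t r 1 1 + t r 2 1 = 0)"
      using single pair1 pair2 by (simp only: ball_Un ball_UN ball_simps) blast
  qed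
qed

text \<open>
  Conversely, the homogeneous coordinates of the point with given slot coordinates on which all
  pairs satisfy their equations.
\<close>

definition single_point :: "(nat \<times> nat \<Rightarrow> real) \<Rightarrow> nat \<Rightarrow> nat \<Rightarrow> real" where
  "single_point w q a = (if a = 1 then w (b q) else 1)"

definition pair_point :: "(nat \<times> nat \<Rightarrow> real) \<Rightarrow> nat \<Rightarrow> nat \<Rightarrow> nat \<Rightarrow> real" where
  "pair_point w r a a' = (if a = 1 \<and> a' = 1 then w (pair_slot r)
     else if a = 2 \<and> a' = 2 then 1 else - w (pair_slot r))"

definition slot_tensor :: "(nat \<times> nat \<Rightarrow> real) \<Rightarrow> (nat \<Rightarrow> nat) \<Rightarrow> real" where
  "slot_tensor w = segre N l (single_point w) (pair_point w)"

lemma slot_tensor_cong: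
  assumes "\<And>u. u \<in> slots \<Longrightarrow> w u = w' u" shows "slot_tensor w = slot_tensor w'"
proof -
  have w: "w (b q) = w' (b q)" if "q \<in> {1..M}" for q
    using that by (intro assms) (auto simp: slots_eq)
  have w2: "w (pair_slot r) = w' (pair_slot r)" if "r \<in> {1..l}" for r
    using that by (intro assms) (auto simp: slots_eq)
  show ?thesis
    unfolding slot_tensor_def segre_def
    by (intro ext arg_cong2[where f = "(*)"] prod.cong refl)
       (auto simp: single_point_def pair_point_def w w2)
qed

lemma slot_coord_point: "u \<in> slots \<Longrightarrow> slot_coord (single_point w) (pair_point w) u = w u"
  by (auto simp: slots_eq single_point_def pair_point_def)

lemma normalised_point: "normalised (single_point w) (pair_point w)"
  by (simp add: normalised_def single_point_def pair_point_def)

text \<open>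
  The profile is the one in which only the owners of the slot make the first choice. It is
  through these profiles that the affine coordinates are read off a projective point.
\<close>

lemma marked_profile:
  assumes "u \<in> slots"
  shows "\<exists>j \<in> profiles N. \<forall>w. slot_tensor w j = w u"
  using assms unfolding slots_eq
proof
  assume "u \<in> b ` {1..M}"
  then obtain q where q: "q \<in> {1..M}" "u = b q" by blast
  let ?j = "\<lambda>i \<in> {1..N}. if i = q then 1 else (2 :: nat)"
  have "(\<Prod>i \<in> {1..M}. single_point w i (?j i)) = (\<Prod>i \<in> {1..M}. if i = q then w u else 1)" for w
    by (rule prod.cong) (auto simp: single_point_def q)
  moreover have "(\<Prod>r \<in> {1..l}. pair_point w r (?j (M + 2 * r - 1)) (?j (M + 2 * r))) = 1" for w
    by (rule prod.neutral) (use q in \<open>auto simp: pair_point_def\<close>)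
  ultimately have "slot_tensor w ?j = w u" for w
    using q by (simp add: slot_tensor_def segre_def)
  moreover have "?j \<in> profiles N" by (auto simp: profiles_def)
  ultimately show ?thesis by blast
next
  assume "u \<in> pair_slot ` {1..l}"
  then obtain r where r: "r \<in> {1..l}" "u = pair_slot r" by blast
  let ?j = "\<lambda>i \<in> {1..N}. if i = M + 2 * r - 1 \<or> i = M + 2 * r then 1 else (2 :: nat)"
  have "(\<Prod>i \<in> {1..M}. single_point w i (?j i)) = 1" for w
    by (rule prod.neutral) (use r in \<open>auto simp: single_point_def\<close>)
  moreover have "(\<Prod>r' \<in> {1..l}. pair_point w r' (?j (M + 2 * r' - 1)) (?j (M + 2 * r'))) =
      (\<Prod>r' \<in> {1..l}. if r' = r then w u else 1)" for w
  proof (rule prod.cong[OF refl])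
    fix r' assume r': "r' \<in> {1..l}"
    then have "?j (M + 2 * r' - 1) = (if r' = r then 1 else 2)" "?j (M + 2 * r') = (if r' = r then 1 else 2)"
      using r(1) by auto
    then show "pair_point w r' (?j (M + 2 * r' - 1)) (?j (M + 2 * r')) = (if r' = r then w u else 1)"
      using r(2) by (simp add: pair_point_def)
  qed
  ultimately have "slot_tensor w ?j = w u" for w
    using r by (simp add: slot_tensor_def segre_def)
  moreover have "?j \<in> profiles N" by (auto simp: profiles_def)
  ultimately show ?thesis by blast
qed

lemma second_choices:
  shows "(\<lambda>i \<in> {1..N}. 2) \<in> profiles N"
    and "segre N l s t (\<lambda>i \<in> {1..N}. 2) = (\<Prod>i \<in> {1..M}. s i 2) * (\<Prod>r \<in> {1..l}. t r 2 2)"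
proof -
  show "(\<lambda>i \<in> {1..N}. 2) \<in> profiles N" by (auto simp: profiles_def)
  have "(\<Prod>i \<in> {1..M}. s i ((\<lambda>i \<in> {1..N}. 2) i)) = (\<Prod>i \<in> {1..M}. s i 2)"
    by (rule prod.cong) auto
  moreover have "(\<Prod>r \<in> {1..l}. t r ((\<lambda>i \<in> {1..N}. 2) (M + 2 * r - 1)) ((\<lambda>i \<in> {1..N}. 2) (M + 2 * r))) =
      (\<Prod>r \<in> {1..l}. t r 2 2)"
    by (rule prod.cong) auto
  ultimately show "segre N l s t (\<lambda>i \<in> {1..N}. 2) = (\<Prod>i \<in> {1..M}. s i 2) * (\<Prod>r \<in> {1..l}. t r 2 2)"
    by (simp add: segre_def)
qed

end


section \<open>The slot equations of a polynomial system\<close>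

context slot_assignment
begin

text \<open>
  The value of a slot at an affine point. If \<open>d i = 1\<close>, there are only two slots for
  the coordinate \<open>i\<close>, and an equation between them would belong to a third player; so the slot
  \<open>(i, 0)\<close> gets the constant 2 instead, which differs from 0, 1 and -1 and so avoids the hyperplanes.
\<close>

definition slot_val :: "(nat \<Rightarrow> real) \<Rightarrow> (nat \<Rightarrow> real) \<Rightarrow> nat \<times> nat \<Rightarrow> real" where
  "slot_val c x u = (if snd u = 0 \<and> d (fst u) = 1 then 2 else x (fst u) - c (fst u))"

text \<open>
  A power of the coordinate \<open>i\<close> becomes a product over distinct slots \<open>(i, 1), (i, 2), \<dots>\<close>;
  the translation is undone inside each factor.
\<close>

definition multilinearised :: "(nat \<Rightarrow> real) \<Rightarrow> nat rpoly \<Rightarrow> (nat \<times> nat \<Rightarrow> real) \<Rightarrow> real" where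
  "multilinearised c P w = (\<Sum>\<mu> \<in> Poly_Mapping.keys P. Poly_Mapping.lookup P \<mu> *
     (\<Prod>u \<in> (SIGMA i:{1..n}. {1..Poly_Mapping.lookup \<mu> i}). w u + c (fst u)))"

definition slot_eq ::
  "nat \<Rightarrow> (nat \<Rightarrow> nat rpoly) \<Rightarrow> (nat \<Rightarrow> real) \<Rightarrow> nat \<times> nat \<Rightarrow> (nat \<times> nat \<Rightarrow> real) \<Rightarrow> real" where
  "slot_eq m G c u w = (let i = fst u; k = snd u in
     if k = 0 then (if i \<le> m then multilinearised c (G i) w else 0)
     else if d i = 1 then w (i, 0) - 2
     else w (i, if k = 1 then d i else k - 1) - w (i, 0))"

lemma multilinearised_eq_peval:
  assumes P: "P \<in> polys {1..n}"
    and deg: "\<And>\<mu> i. \<mu> \<in> Poly_Mapping.keys P \<Longrightarrow> i \<in> {1..n} \<Longrightarrow> Poly_Mapping.lookup \<mu> i \<le> d i"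
    and w: "\<And>u. u \<in> slots \<Longrightarrow> w u = slot_val c x u"
  shows "multilinearised c P w = peval x P"
  unfolding multilinearised_def peval_def
proof (intro sum.cong refl arg_cong2[where f = "(*)"])
  fix \<mu> assume \<mu>: "\<mu> \<in> Poly_Mapping.keys P"
  have "w (i, k) + c i = x i" if "i \<in> {1..n}" "k \<in> {1..Poly_Mapping.lookup \<mu> i}" for i k
  proof -
    have "(i, k) \<in> slots" using that deg[OF \<mu>, of i] by (auto simp: slots_def)
    then show ?thesis using w[of "(i, k)"] that by (simp add: slot_val_def)
  qed
  then have "(\<Prod>u \<in> (SIGMA i:{1..n}. {1..Poly_Mapping.lookup \<mu> i}). w u + c (fst u)) =
      (\<Prod>u \<in> (SIGMA i:{1..n}. {1..Poly_Mapping.lookup \<mu> i}). x (fst u))"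
    by (intro prod.cong refl) auto
  also have "\<dots> = (\<Prod>i \<in> {1..n}. \<Prod>k \<in> {1..Poly_Mapping.lookup \<mu> i}. x i)"
    by (subst prod.Sigma) (auto simp: case_prod_beta)
  also have "\<dots> = (\<Prod>i \<in> {1..n}. x i ^ Poly_Mapping.lookup \<mu> i)"
    by simp
  also have "\<dots> = (\<Prod>i \<in> Poly_Mapping.keys \<mu>. x i ^ Poly_Mapping.lookup \<mu> i)"
    using P \<mu> by (intro monomial_value_superset[symmetric]) (auto simp: polys_def)
  finally show "(\<Prod>u \<in> (SIGMA i:{1..n}. {1..Poly_Mapping.lookup \<mu> i}). w u + c (fst u)) =
      (\<Prod>i \<in> Poly_Mapping.keys \<mu>. x i ^ Poly_Mapping.lookup \<mu> i)" .
qed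

text \<open>
  The equation of a slot never involves the slot itself: polynomial equations belong to
  slots \<open>(i, 0)\<close> but involve slots \<open>(i, k)\<close> with \<open>k \<ge> 1\<close> only, and the equation of
  \<open>(i, k)\<close> involves only \<open>(i, 0)\<close> and, if \<open>d i \<ge> 2\<close>, the cyclic predecessor of \<open>k\<close> among
  \<open>1, \<dots>, d i\<close>.
\<close>

lemma payoff_form_slot_eq:
  assumes deg: "\<And>k \<mu> i. k \<in> {1..m} \<Longrightarrow> \<mu> \<in> Poly_Mapping.keys (G k) \<Longrightarrow> i \<in> {1..n} \<Longrightarrow>
      Poly_Mapping.lookup \<mu> i \<le> d i"
    and q: "q \<in> {1..M}"
  shows "payoff_form q (slot_eq m G c (b q))"
proof -
  obtain i k where u: "b q = (i, k)" by (cases "b q")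
  then have ik: "i \<in> {1..n}" "k \<le> d i" using b_single[OF q] by (auto simp: singles_def)
  consider "k = 0" "i \<le> m" | "k = 0" "\<not> i \<le> m" | "k \<noteq> 0" "d i = 1" | "k \<noteq> 0" "d i \<noteq> 1" by blast
  then show ?thesis
  proof cases
    case 1
    have "payoff_form q (multilinearised c (G i))"
      unfolding multilinearised_def
    proof (intro payoff_form_sum payoff_form_scale payoff_form_prod[OF q])
      fix \<mu> assume "\<mu> \<in> Poly_Mapping.keys (G i)"
      then show "(SIGMA i:{1..n}. {1..Poly_Mapping.lookup \<mu> i}) \<subseteq> slots"
        using deg[of i \<mu>] 1 ik by (fastforce simp: slots_def)
      show "b q \<notin> (SIGMA i:{1..n}. {1..Poly_Mapping.lookup \<mu> i})" using 1 u by auto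
    qed
    then show ?thesis using 1 by (simp add: slot_eq_def[abs_def] u)
  next
    case 2
    then show ?thesis by (simp add: slot_eq_def[abs_def] u payoff_form_zero)
  next
    case 3
    have "payoff_form q (\<lambda>w. w (i, 0) - 2)"
      by (intro payoff_form_diff payoff_form_const payoff_form_coord q)
         (use 3 ik u in \<open>auto simp: slots_def\<close>)
    then show ?thesis using 3 by (simp add: slot_eq_def[abs_def] u)
  next
    case 4
    have "payoff_form q (\<lambda>w. w (i, if k = 1 then d i else k - 1) - w (i, 0))"
      by (intro payoff_form_diff payoff_form_coord q)
         (use 4 ik u in \<open>auto simp: slots_def\<close>)
    then show ?thesis using 4 by (simp add: slot_eq_def[abs_def] u)
  qed
qed

text \<open>
  If \<open>d i \<ge> 2\<close>, the equations of the slots \<open>(i, k)\<close> make all slots of the coordinate \<open>i\<close> equal.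
  If \<open>d i \<le> 1\<close>, the only slot that is not fixed is \<open>(i, d i)\<close>. So the slot \<open>(i, d i)\<close> always
  determines \<open>x i\<close>.
\<close>

lemma slot_eq_solutions:
  assumes G: "\<And>k. k \<in> {1..m} \<Longrightarrow> G k \<in> polys {1..n}"
    and deg: "\<And>k \<mu> i. k \<in> {1..m} \<Longrightarrow> \<mu> \<in> Poly_Mapping.keys (G k) \<Longrightarrow> i \<in> {1..n} \<Longrightarrow>
      Poly_Mapping.lookup \<mu> i \<le> d i"
    and m: "m \<le> n - l"
  shows "(\<forall>u \<in> singles. slot_eq m G c u w = 0) \<longleftrightarrow>
    (\<exists>x \<in> zero_locus {1..n} (G ` {1..m}). \<forall>u \<in> slots. w u = slot_val c x u)"
proof
  assume eq: "\<forall>u \<in> singles. slot_eq m G c u w = 0"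
  define x where "x = (\<lambda>i \<in> {1..n}. c i + w (i, d i))"
  have w: "w u = slot_val c x u" if u: "u \<in> slots" for u
  proof -
    obtain i k where ik: "u = (i, k)" "i \<in> {1..n}" "k \<le> d i" using u by (auto simp: slots_def)
    have copy: "slot_eq m G c (i, k') w = 0" if "k' \<in> {1..d i}" for k'
      using eq ik that by (auto simp: singles_def)
    consider "d i = 0" | "d i = 1" | "d i \<ge> 2" by linarith
    then show ?thesis
    proof cases
      case 1
      then show ?thesis using ik by (simp add: slot_val_def x_def)
    next
      case 2
      then have "w (i, 0) = 2" using copy[of 1] by (simp add: slot_eq_def Let_def)
      moreover have "k = 0 \<or> k = 1" using 2 ik(3) by linarith
      ultimately show ?thesis using 2 ik by (auto simp: slot_val_def x_def)
    next
      case 3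
      then have last: "w (i, d i) = w (i, 0)" using copy[of 1] by (simp add: slot_eq_def Let_def)
      have "w (i, k) = w (i, 0)" if "k \<noteq> 0" "k \<noteq> d i"
        using copy[of "Suc k"] that ik 3 by (simp add: slot_eq_def Let_def)
      then have "w (i, k) = w (i, 0)" using last by (cases "k = 0 \<or> k = d i") auto
      then show ?thesis using last ik 3 by (auto simp: slot_val_def x_def)
    qed
  qed
  have "peval x (G k) = 0" if k: "k \<in> {1..m}" for k
  proof -
    have "multilinearised c (G k) w = 0"
    proof -
      have "k \<le> n - l" "k \<le> n" using k m by auto
      then show ?thesis using bspec[OF eq, of "(k, 0)"] k by (simp add: singles_def slot_eq_def)
    qed
    then show ?thesis using multilinearised_eq_peval[OF G[OF k] deg[OF k] w] by simp
  qed
  then have "x \<in> zero_locus {1..n} (G ` {1..m})"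
    by (auto simp: zero_locus_def affine_space_def x_def)
  with w show "\<exists>x \<in> zero_locus {1..n} (G ` {1..m}). \<forall>u \<in> slots. w u = slot_val c x u" by blast
next
  assume "\<exists>x \<in> zero_locus {1..n} (G ` {1..m}). \<forall>u \<in> slots. w u = slot_val c x u"
  then obtain x where x: "x \<in> zero_locus {1..n} (G ` {1..m})"
    and w: "\<And>u. u \<in> slots \<Longrightarrow> w u = slot_val c x u" by blast
  show "\<forall>u \<in> singles. slot_eq m G c u w = 0"
  proof
    fix u assume u: "u \<in> singles"
    then obtain i k where ik: "u = (i, k)" "i \<in> {1..n}" "k \<le> d i" by (auto simp: singles_def)
    show "slot_eq m G c u w = 0"
    proof (cases "k = 0")
      case True
      have "multilinearised c (G i) w = 0" if "i \<le> m"
      proof -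
        have i: "i \<in> {1..m}" using that ik by simp
        then have "peval x (G i) = 0" using x by (auto simp: zero_locus_def)
        then show ?thesis using multilinearised_eq_peval[OF G[OF i] deg[OF i] w] by simp
      qed
      then show ?thesis using True ik by (simp add: slot_eq_def)
    next
      case False
      have "(i, 0) \<in> slots" "(i, if k = 1 then d i else k - 1) \<in> slots"
        using ik by (auto simp: slots_def)
      then show ?thesis using False ik w by (auto simp: slot_eq_def slot_val_def Let_def)
    qed
  qed
qed

lemma poly_fun_if: "poly_fun I f \<Longrightarrow> poly_fun I g \<Longrightarrow> poly_fun I (\<lambda>x. if p then f x else g x)"
  by (cases p) simp_all

lemma poly_fun_slot_val: "u \<in> slots \<Longrightarrow> poly_fun {1..n} (\<lambda>x. slot_val c x u)"
  by (cases "snd u = 0 \<and> d (fst u) = 1")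
     (auto simp: slot_val_def slots_def intro!: poly_fun_const poly_fun_diff poly_fun_var)

lemma poly_fun_slot_tensor: "poly_fun {1..n} (\<lambda>x. slot_tensor (slot_val c x) j)"
proof -
  have single: "poly_fun {1..n} (\<lambda>x. slot_val c x (b q))" if "q \<in> {1..M}" for q
    using that by (intro poly_fun_slot_val) (auto simp: slots_eq)
  have pair: "poly_fun {1..n} (\<lambda>x. slot_val c x (pair_slot r))" if "r \<in> {1..l}" for r
    using that by (intro poly_fun_slot_val) (auto simp: slots_eq)
  have neg: "poly_fun {1..n} (\<lambda>x. - slot_val c x (pair_slot r))" if "r \<in> {1..l}" for r
    using poly_fun_diff[OF poly_fun_const[of _ 0] pair[OF that]] by simp
  have "poly_fun {1..n} (\<lambda>x. single_point (slot_val c x) q a)" if "q \<in> {1..M}" for q a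
    unfolding single_point_def by (intro poly_fun_if single[OF that] poly_fun_const)
  moreover have "poly_fun {1..n} (\<lambda>x. pair_point (slot_val c x) r a a')" if "r \<in> {1..l}" for r a a'
    unfolding pair_point_def by (intro poly_fun_if pair[OF that] neg[OF that] poly_fun_const)
  ultimately show ?thesis
    unfolding slot_tensor_def segre_def by (intro poly_fun_mult poly_fun_prod) simp_all
qed

lemma polynomial_graph_slot_tensor:
  obtains coord where
    "polynomial_graph {1..n} (profiles N) (\<lambda>x. slot_tensor (slot_val c x)) (\<lambda>i \<in> {1..N}. 2) coord c"
proof -
  have "\<forall>i \<in> {1..n}. \<exists>j. j \<in> profiles N \<and> (\<forall>w. slot_tensor w j = w (i, d i))"
    using marked_profile by (force simp: slots_def)
  from bchoice[OF this] obtain coord where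
    coord: "\<forall>i \<in> {1..n}. coord i \<in> profiles N \<and> (\<forall>w. slot_tensor w (coord i) = w (i, d i))" ..
  have "polynomial_graph {1..n} (profiles N) (\<lambda>x. slot_tensor (slot_val c x)) (\<lambda>i \<in> {1..N}. 2) coord c"
  proof
    show "slot_tensor (slot_val c x) (\<lambda>i \<in> {1..N}. 2) = 1" for x
      unfolding slot_tensor_def second_choices by (simp add: single_point_def pair_point_def)
    show "slot_tensor (slot_val c x) (coord i) = x i - c i" if "i \<in> {1..n}" for x i
      using coord that by (simp add: slot_val_def)
    show "coord i \<in> profiles N" if "i \<in> {1..n}" for i using coord that by blast
  qed (rule second_choices poly_fun_slot_tensor)+
  then show ?thesis by (rule that)
qed

lemma segre_chart:
  assumes "\<And>i. i \<in> {1..M} \<Longrightarrow> s i 2 \<noteq> 0" "\<And>r. r \<in> {1..l} \<Longrightarrow> t r 2 2 \<noteq> 0"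
  shows "segre N l s t (\<lambda>i \<in> {1..N}. 2) \<noteq> 0"
  unfolding second_choices using assms by simp

text \<open>
  The points of the Spohn variety and the independence model off the hyperplanes form the part of
  the graph over \<open>S\<close> that avoids the hyperplanes. By the generic translation this part is dense in
  the graph, so its closure in the chart is the whole graph.
\<close>

theorem nash_ci_affine_isomorphic:
  assumes G: "\<And>k. k \<in> {1..m} \<Longrightarrow> G k \<in> polys {1..n}"
    and deg: "\<And>k \<mu> i. k \<in> {1..m} \<Longrightarrow> \<mu> \<in> Poly_Mapping.keys (G k) \<Longrightarrow> i \<in> {1..n} \<Longrightarrow>
      Poly_Mapping.lookup \<mu> i \<le> d i"
    and m: "m \<le> n - l"
  shows "\<exists>X :: game. isomorphic_varieties
    (quasiproj_variety (profiles N) (nash_ci_affine N X l))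
    (affine_variety {1..n} (zero_locus {1..n} (G ` {1..m})))"
proof -
  let ?S = "zero_locus {1..n} (G ` {1..m})"
  have S: "?S \<subseteq> affine_space {1..n}" by (auto simp: zero_locus_def)
  obtain c where generic:
    "\<And>T x. openin (zariski_affine {1..n}) T \<Longrightarrow> x \<in> T \<Longrightarrow> x \<in> ?S \<Longrightarrow> ?S \<subseteq> affine_space {1..n} \<Longrightarrow>
       \<exists>y \<in> T \<inter> ?S. \<forall>i \<in> {1..n}. y i - c i \<notin> {-1, 0, 1}"
    using generic_translation[where S = ?S and I = "{1..n}"] by (metis finite_atLeastAtMost)
  obtain coord where
    "polynomial_graph {1..n} (profiles N) (\<lambda>x. slot_tensor (slot_val c x)) (\<lambda>i \<in> {1..N}. 2) coord c"
    using polynomial_graph_slot_tensor .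
  then interpret graph: polynomial_graph "{1..n}" "profiles N" "\<lambda>x. slot_tensor (slot_val c x)"
    "\<lambda>i \<in> {1..N}. 2" coord c .
  have forms: "payoff_form q (slot_eq m G c (b q))" if "q \<in> {1..M}" for q
    by (rule payoff_form_slot_eq[where m = m and G = G, OF deg that])
  obtain X :: game where X: "\<And>s t. normalised s t \<Longrightarrow> off_hyperplanes M l s t \<Longrightarrow>
      (\<forall>i \<in> {1..N}. det (spohn_matrix N X i (segre N l s t)) = 0) \<longleftrightarrow>
      (\<forall>q \<in> {1..M}. slot_eq m G c (b q) (slot_coord s t) = 0) \<and>
      (\<forall>r \<in> {1..l}. t r 1 1 + t r 1 2 = 0 \<and> t r 1 1 + t r 2 1 = 0)"
    by (rule exists_game[of "\<lambda>q. slot_eq m G c (b q)", OF forms]) blast+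
  have solutions: "(\<forall>q \<in> {1..M}. slot_eq m G c (b q) w = 0) \<longleftrightarrow>
      (\<exists>x \<in> ?S. \<forall>u \<in> slots. w u = slot_val c x u)" for w
  proof -
    have "(\<forall>u \<in> singles. slot_eq m G c u w = 0) \<longleftrightarrow> (\<exists>x \<in> ?S. \<forall>u \<in> slots. w u = slot_val c x u)"
      by (rule slot_eq_solutions[where m = m and G = G, OF G deg m])
    then show ?thesis unfolding b_image[symmetric] by simp
  qed
  let ?A = "spohn_variety N X \<inter> indep_model N l - excluded_hyperplanes N"
  have in_A: "graph.embed x \<in> ?A" if x: "x \<in> ?S" and xc: "\<forall>i \<in> {1..n}. x i - c i \<notin> {-1, 0, 1}" for x
  proof -
    let ?s = "single_point (slot_val c x)" and ?t = "pair_point (slot_val c x)"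
    have val: "slot_val c x u \<noteq> 0 \<and> slot_val c x u + 1 \<noteq> 0 \<and> 1 - slot_val c x u \<noteq> 0" if "u \<in> slots" for u
    proof -
      have "fst u \<in> {1..n}" using that by (auto simp: slots_def)
      with xc have "x (fst u) - c (fst u) \<notin> {-1, 0, 1}" by blast
      then show ?thesis by (auto simp: slot_val_def)
    qed
    have off: "off_hyperplanes M l ?s ?t"
      using val unfolding off_hyperplanes_def slots_eq
      by (auto simp: single_point_def pair_point_def)
    have eq: "graph.embed x = proj_point (profiles N) (segre N l ?s ?t)"
      unfolding graph.embed_def by (simp add: slot_tensor_def)
    have "graph.embed x \<notin> excluded_hyperplanes N"
      using proj_point_off_hyperplanes[of M l ?s ?t] off graph.embed_in_proj_space[of x] by (simp add: eq)
    moreover have "graph.embed x \<in> indep_model N l"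
      unfolding eq indep_model_def
    proof (intro CollectI exI[of _ ?s] exI[of _ ?t] conjI refl ballI)
      show "\<exists>a \<in> {1, 2}. ?s i a \<noteq> 0" for i by (intro bexI[of _ 2]) (auto simp: single_point_def)
      show "\<exists>a \<in> {1, 2}. \<exists>b \<in> {1, 2}. ?t r a b \<noteq> 0" for r
        by (intro bexI[of _ 2]) (auto simp: pair_point_def)
    qed
    moreover have "graph.embed x \<in> spohn_variety N X"
    proof -
      have "\<forall>u \<in> slots. slot_coord ?s ?t u = slot_val c x u" by (simp add: slot_coord_point)
      with x have "\<forall>q \<in> {1..M}. slot_eq m G c (b q) (slot_coord ?s ?t) = 0"
        unfolding solutions by blast
      moreover have "\<forall>r \<in> {1..l}. ?t r 1 1 + ?t r 1 2 = 0 \<and> ?t r 1 1 + ?t r 2 1 = 0"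
        by (simp add: pair_point_def)
      ultimately have "\<forall>i \<in> {1..N}. det (spohn_matrix N X i (segre N l ?s ?t)) = 0"
        using X[OF normalised_point off] by blast
      moreover have "segre N l ?s ?t (\<lambda>i \<in> {1..N}. 2) \<noteq> 0"
        by (rule segre_chart) (simp_all add: single_point_def pair_point_def)
      ultimately show ?thesis
        unfolding eq using proj_point_in_spohn_variety[OF second_choices(1)] by blast
    qed
    ultimately show ?thesis by blast
  qed
  have from_A: "\<exists>x \<in> ?S. p = graph.embed x" if p: "p \<in> ?A" for p
  proof -
    obtain s t where p_eq: "p = proj_point (profiles N) (segre N l s t)"
      using p by (auto simp: indep_model_def)
    have off: "off_hyperplanes M l s t"
      using p proj_point_off_hyperplanes[of M l s t] by (auto simp: p_eq spohn_variety_def)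
    let ?s = "\<lambda>i a. s i a / s i 2" and ?t = "\<lambda>r a a'. t r a a' / t r 2 2"
    have p_eq': "p = proj_point (profiles N) (segre N l ?s ?t)"
      unfolding p_eq by (rule segre_normalise) (use off in \<open>auto simp: off_hyperplanes_def\<close>)
    have norm: "normalised ?s ?t" using off by (auto simp: off_hyperplanes_def normalised_def)
    have off': "off_hyperplanes M l ?s ?t"
      using p proj_point_off_hyperplanes[of M l ?s ?t] by (auto simp: p_eq' spohn_variety_def)
    have "segre N l ?s ?t (\<lambda>i \<in> {1..N}. 2) \<noteq> 0"
      by (rule segre_chart) (use off' in \<open>auto simp: off_hyperplanes_def\<close>)
    then have "\<forall>i \<in> {1..N}. det (spohn_matrix N X i (segre N l ?s ?t)) = 0"
      using p proj_point_in_spohn_variety[OF second_choices(1), of "segre N l ?s ?t" X]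
      by (auto simp: p_eq')
    then have eqs: "\<forall>q \<in> {1..M}. slot_eq m G c (b q) (slot_coord ?s ?t) = 0"
      and line: "\<forall>r \<in> {1..l}. ?t r 1 1 + ?t r 1 2 = 0 \<and> ?t r 1 1 + ?t r 2 1 = 0"
      unfolding X[OF norm off'] by blast+
    from eqs obtain x where x: "x \<in> ?S" "\<forall>u \<in> slots. slot_coord ?s ?t u = slot_val c x u"
      unfolding solutions by blast
    have "p = graph.embed x"
      unfolding p_eq' graph.embed_def
    proof (rule proj_point_eqI[of 1])
      fix j assume j: "j \<in> profiles N"
      have "segre N l ?s ?t j = slot_tensor (slot_coord ?s ?t) j"
        unfolding slot_tensor_def
      proof (rule segre_cong[OF _ _ j])
        show "?s i a = single_point (slot_coord ?s ?t) i a" if "i \<in> {1..M}" "a \<in> {1, 2}" for i a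
          using that off by (auto simp: single_point_def off_hyperplanes_def)
        show "?t r a a' = pair_point (slot_coord ?s ?t) r a a'"
          if "r \<in> {1..l}" "a \<in> {1, 2}" "a' \<in> {1, 2}" for r a a'
        proof -
          have "?t r 1 1 + ?t r 1 2 = 0" "?t r 1 1 + ?t r 2 1 = 0" "?t r 2 2 = 1"
            using line norm that(1) unfolding normalised_def by blast+
          then show ?thesis using that by (auto simp: pair_point_def)
        qed
      qed
      also have "slot_tensor (slot_coord ?s ?t) = slot_tensor (slot_val c x)"
        by (rule slot_tensor_cong) (use x(2) in blast)
      finally show "segre N l ?s ?t j = 1 * slot_tensor (slot_val c x) j" by simp
    qed simp
    with x(1) show ?thesis by blast
  qed
  let ?U = "{x \<in> ?S. graph.embed x \<in> ?A}"
  have A_eq: "?A = graph.embed ` ?U" using from_A by blast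
  have variety: "nash_ci_variety N X l = zariski_proj (profiles N) closure_of (graph.embed ` ?U)"
    unfolding nash_ci_variety_def by (rule arg_cong[OF A_eq])
  have closure: "proj_point (profiles N) v \<in> nash_ci_variety N X l \<longleftrightarrow>
      proj_point (profiles N) v \<in> graph.embed ` ?S" if "v (\<lambda>i \<in> {1..N}. 2) \<noteq> 0" for v
    unfolding variety
  proof (rule graph.closure_of_embedding[where u = v, OF _ _ _ that])
    show "G ` {1..m} \<subseteq> polys {1..n}" using G by blast
    show "?U \<subseteq> ?S" by blast
    \<comment> \<open>Near every point of \<open>S\<close> there are points whose coordinates avoid the hyperplanes.\<close>
    fix T x assume "openin (zariski_affine {1..n}) T" "x \<in> T" "x \<in> ?S"
    from generic[OF this S] obtain y where "y \<in> T \<inter> ?S" "\<forall>i \<in> {1..n}. y i - c i \<notin> {-1, 0, 1}" ..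
    then show "T \<inter> ?U \<noteq> {}" using in_A[of y] by blast
  qed
  have chart: "nash_ci_affine N X l = graph.embed ` ?S"
  proof (intro equalityI subsetI)
    fix p assume "p \<in> nash_ci_affine N X l"
    then obtain s t where p: "p = proj_point (profiles N) (segre N l s t)" "p \<in> nash_ci_variety N X l"
      and "\<forall>i \<in> {1..M}. s i 2 \<noteq> 0" "\<forall>r \<in> {1..l}. t r 2 2 \<noteq> 0"
      by (auto simp: nash_ci_affine_def)
    then have "segre N l s t (\<lambda>i \<in> {1..N}. 2) \<noteq> 0" by (intro segre_chart) auto
    then show "p \<in> graph.embed ` ?S" using p closure by blast
  next
    fix p assume p: "p \<in> graph.embed ` ?S"
    then obtain x where x: "p = graph.embed x" by blast
    let ?s = "single_point (slot_val c x)" and ?t = "pair_point (slot_val c x)"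
    have eq: "p = proj_point (profiles N) (segre N l ?s ?t)"
      unfolding x graph.embed_def by (simp add: slot_tensor_def)
    have st: "?s i 2 \<noteq> 0" "?t r 2 2 \<noteq> 0" for i r
      by (simp_all add: single_point_def pair_point_def)
    then have "p \<in> nash_ci_variety N X l"
      using p closure[of "segre N l ?s ?t"] segre_chart[of ?s ?t] by (simp add: eq)
    then show "p \<in> nash_ci_affine N X l"
      unfolding nash_ci_affine_def using eq st by blast
  qed
  show ?thesis
    by (rule exI[of _ X]) (simp only: chart graph.isomorphic_embedding[OF S])
qed

end

lemma lookup_le_max_deg_in:
  assumes "k \<in> {1..m}" "\<mu> \<in> Poly_Mapping.keys (G k)"
  shows "Poly_Mapping.lookup \<mu> i \<le> max_deg_in m G i"
proof -
  have "Poly_Mapping.lookup \<mu> i \<le> deg_in i (G k)"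
    unfolding deg_in_def using assms(2) by (intro Max_ge) auto
  also have "\<dots> \<le> max_deg_in m G i"
    unfolding max_deg_in_def using assms(1) by (intro Max_ge) auto
  finally show ?thesis .
qed

lemma card_singles:
  fixes d :: "nat \<Rightarrow> nat"
  assumes "l \<le> n"
  shows "finite {(i, k). i \<in> {1..n} \<and> k \<le> d i \<and> (k = 0 \<longrightarrow> i \<le> n - l)}"
    and "card {(i, k). i \<in> {1..n} \<and> k \<le> d i \<and> (k = 0 \<longrightarrow> i \<le> n - l)} = (\<Sum>i \<in> {1..n}. d i) + n - l"
proof -
  have eq: "{(i, k). i \<in> {1..n} \<and> k \<le> d i \<and> (k = 0 \<longrightarrow> i \<le> n - l)} =
      (SIGMA i:{1..n}. {1..d i}) \<union> {1..n - l} \<times> {0}"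
    by auto
  show "finite {(i, k). i \<in> {1..n} \<and> k \<le> d i \<and> (k = 0 \<longrightarrow> i \<le> n - l)}"
    unfolding eq by auto
  have "(SIGMA i:{1..n}. {1..d i}) \<inter> {1..n - l} \<times> {0} = {}" by auto
  then show "card {(i, k). i \<in> {1..n} \<and> k \<le> d i \<and> (k = 0 \<longrightarrow> i \<le> n - l)} = (\<Sum>i \<in> {1..n}. d i) + n - l"
    unfolding eq using assms by (subst card_Un_disjoint) (auto simp: card_cartesian_product)
qed

theorem theorem33:
  fixes l n m \<delta> :: nat
    and G :: "nat \<Rightarrow> nat rpoly"
    and S :: "(nat \<Rightarrow> real) set"
  assumes "\<And>k. k \<in> {1..m} \<Longrightarrow> G k \<in> polys {1..n}"
    and "S = zero_locus {1..n} (G ` {1..m})"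
    and "int m \<le> int n - int l"
    and "\<delta> = (\<Sum>i \<in> {1..n}. max_deg_in m G i)"
  shows "\<exists>X :: game. isomorphic_varieties
           (quasiproj_variety (profiles (\<delta> + n + l)) (nash_ci_affine (\<delta> + n + l) X l))
           (affine_variety {1..n} S)"
proof -
  have l: "l \<le> n" and m: "m \<le> n - l" using assms(3) by linarith+
  let ?M = "\<delta> + n - l" and ?d = "max_deg_in m G"
  obtain b where "bij_betw b {1..?M} {(i, k). i \<in> {1..n} \<and> k \<le> ?d i \<and> (k = 0 \<longrightarrow> i \<le> n - l)}"
    using finite_same_card_bij[OF finite_atLeastAtMost[of 1 ?M] card_singles(1)[OF l, of ?d]]
      card_singles(2)[OF l, of ?d] assms(4)
    by auto
  then interpret slot_assignment n l ?M ?d b using l by unfold_locales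
  have N: "?M + 2 * l = \<delta> + n + l" using l by simp
  have "Poly_Mapping.lookup \<mu> i \<le> ?d i"
    if "k \<in> {1..m}" "\<mu> \<in> Poly_Mapping.keys (G k)" "i \<in> {1..n}" for k \<mu> i
    using that(1,2) by (rule lookup_le_max_deg_in)
  from nash_ci_affine_isomorphic[where m = m and G = G, OF assms(1) this m] show ?thesis
    unfolding N assms(2) .
qed

end
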